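(* Let $\mathfrak{g}_h$ be an $n$-dimensional Lie algebra over $\mathbb{K}$ ($\mathbb{K}=\mathbb{R}$ or $\mathbb{C}$) with basis $X_1,\dots,X_n$ and $[X_\mu,X_\nu]=\sum_{\alpha=1}^n C_{\mu\nu\alpha}X_\alpha$, where $C_{\mu\nu\alpha}=C_{\mu\nu\alpha}(h)$ depends on a parameter $h\in\mathbb{R}$ with $\lim_{h\to0}C_{\mu\nu\alpha}(h)=0$. Let $\mathbf{C}$ be the $n\times n$ matrix with entries $\mathbf{C}_{\mu\nu}=\sum_{\alpha=1}^n C_{\mu\alpha\nu}\partial_\alpha$. Then the realization of $\mathfrak{g}_h$ in the semicompleted Weyl algebra $\hat{\mathcal{A}}_n$ given by $$X_\mu\mapsto\hat x_\mu=\sum_{\alpha=1}^n x_\alpha\,\psi_{\mu\alpha}(\mathbf{C})=\sum_{k=0}^\infty\sum_{\alpha=1}^n\frac{(-1)^k}{k!}B_k\,x_\alpha(\mathbf{C}^k)_{\mu\alpha}$$ satisfies the symmetrization property $$\Big(\sum_{\mu=1}^n k_\mu\hat x_\mu\Big)^m\rhd 1=\Big(\sum_{\mu=1}^n k_\mu x_\mu\Big)^m\qquad\text{for all } k_1,\dots,k_n\in\mathbb{K},\ m\ge1.$$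
   Context: The Weyl algebra $\mathcal{A}_n$ is the unital associative $\mathbb{K}$-algebra generated by $x_1,\dots,x_n,\partial_1,\dots,\partial_n$ with $[x_\mu,x_\nu]=[\partial_\mu,\partial_\nu]=0$, $[\partial_\mu,x_\nu]=\delta_{\mu\nu}$. $\hat{\mathcal{A}}_n$ is its semicompletion by the order of differential operators: it contains formal power series in the $\partial_\mu$ but only polynomial expressions in the $x_\mu$. $\mathcal{X}=\mathbb{K}[x_1,\dots,x_n]$. The left action $\rhd$ of $\hat{\mathcal{A}}_n$ on $\mathcal{X}$ is given by $x_\mu\rhd f=x_\mu f$, $\partial_\mu\rhd f=\partial f/\partial x_\mu$, $(ab)\rhd f=a\rhd(b\rhd f)$, extended to formal power series in the $\partial_\mu$ in the obvious way (only finitely many terms act nontrivially on a given polynomial). $\psi(t)=\frac{t}{1-e^{-t}}=\sum_{k\ge0}\frac{(-1)^k}{k!}B_kt^k$, where $B_k$ are the Bernoulli numbers with $B_1=-\tfrac12$; $\psi(\mathbf{C})$ is the corresponding formal power series in the matrix $\mathbf{C}$ and $\psi_{\mu\alpha}(\mathbf{C})$ its $(\mu,\alpha)$ entry. *)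

theory Defs
  imports
    "HOL-Analysis.Analysis"
    "HOL-Library.Poly_Mapping"
    "HOL-Computational_Algebra.Formal_Power_Series"
begin

section \<open>Polynomials in finitely many variables\<close>

text \<open>
  Multi-indices over the finite index type \<^typ>\<open>'n\<close>, which plays the role of \<open>{1, \<dots>, n}\<close>,
  and the polynomial algebra on them with the convolution product of
  \<^theory>\<open>HOL-Library.Poly_Mapping\<close>.
\<close>

type_synonym 'n mindex = "'n \<Rightarrow>\<^sub>0 nat"
type_synonym ('k, 'n) mpoly = "('n \<Rightarrow>\<^sub>0 nat) \<Rightarrow>\<^sub>0 'k"

abbreviation lookup :: "('a \<Rightarrow>\<^sub>0 'b::zero) \<Rightarrow> 'a \<Rightarrow> 'b" where
  "lookup \<equiv> Poly_Mapping.lookup"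

abbreviation unit_index :: "'n \<Rightarrow> 'n mindex" where
  "unit_index \<mu> \<equiv> Poly_Mapping.single \<mu> (Suc 0)"

definition Const :: "'k \<Rightarrow> ('k::zero, 'n) mpoly" where
  "Const c = Poly_Mapping.single 0 c"

definition Var :: "'n \<Rightarrow> ('k::zero_neq_one, 'n) mpoly" where
  "Var \<mu> = Poly_Mapping.single (unit_index \<mu>) 1"

text \<open>
  The iterated partial derivative \<open>\<partial>\<^sup>\<kappa>\<close>: the coefficient of \<open>x\<^sup>\<alpha>\<close> in \<open>\<partial>\<^sup>\<kappa> p\<close> is
  \<open>(\<alpha> + \<kappa>)! / \<alpha>!\<close> times that of \<open>x\<^bsup>\<alpha> + \<kappa>\<^esup>\<close> in \<open>p\<close>.
\<close>

definition mpoch :: "'n::finite mindex \<Rightarrow> 'n mindex \<Rightarrow> nat" where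
  "mpoch \<alpha> \<kappa> = (\<Prod>i\<in>UNIV. pochhammer (Suc (lookup \<alpha> i)) (lookup \<kappa> i))"

lift_definition mderiv :: "'n::finite mindex \<Rightarrow> ('k::comm_semiring_1, 'n) mpoly \<Rightarrow> ('k, 'n) mpoly"
  is "\<lambda>\<kappa> p \<alpha>. of_nat (mpoch \<alpha> \<kappa>) * p (\<alpha> + \<kappa>)"
proof -
  fix \<kappa> :: "'n mindex" and p :: "'n mindex \<Rightarrow> 'k"
  assume "finite {\<alpha>. p \<alpha> \<noteq> 0}"
  moreover have "{\<alpha>. of_nat (mpoch \<alpha> \<kappa>) * p (\<alpha> + \<kappa>) \<noteq> 0} \<subseteq> (\<lambda>\<beta>. \<beta> - \<kappa>) ` {\<alpha>. p \<alpha> \<noteq> 0}"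
  proof
    fix \<alpha> assume "\<alpha> \<in> {\<alpha>. of_nat (mpoch \<alpha> \<kappa>) * p (\<alpha> + \<kappa>) \<noteq> 0}"
    then have "p (\<alpha> + \<kappa>) \<noteq> 0" by (auto intro: ccontr)
    then show "\<alpha> \<in> (\<lambda>\<beta>. \<beta> - \<kappa>) ` {\<alpha>. p \<alpha> \<noteq> 0}"
      by (intro image_eqI[of _ _ "\<alpha> + \<kappa>"]) auto
  qed
  ultimately show "finite {\<alpha>. of_nat (mpoch \<alpha> \<kappa>) * p (\<alpha> + \<kappa>) \<noteq> 0}"
    by (meson finite_imageI finite_subset)
qed

definition mbinom :: "'n::finite mindex \<Rightarrow> 'n mindex \<Rightarrow> nat" where
  "mbinom \<epsilon> \<kappa> = (\<Prod>i\<in>UNIV. (lookup \<epsilon> i + lookup \<kappa> i) choose lookup \<epsilon> i)"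

definition splits :: "'n mindex \<Rightarrow> ('n mindex \<times> 'n mindex) set" where
  "splits \<delta> = {(\<epsilon>, \<gamma>). \<epsilon> + \<gamma> = \<delta>}"

definition mderiv_supp :: "('k::comm_semiring_1, 'n::finite) mpoly \<Rightarrow> 'n mindex set" where
  "mderiv_supp p = {\<kappa>. mderiv \<kappa> p \<noteq> 0}"

section \<open>The semicompleted Weyl algebra\<close>

text \<open>
  The completion of the Weyl algebra with respect to the order of differential operators consists
  of the normally ordered series \<open>\<Sum>\<^sub>\<beta> p\<^sub>\<beta>(x) \<partial>\<^sup>\<beta>\<close> with an arbitrary polynomial \<open>p\<^sub>\<beta>\<close> for every
  multi-index \<open>\<beta>\<close>; \<open>wcoeff a \<beta>\<close> is \<open>p\<^sub>\<beta>\<close>.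
\<close>

typedef (overloaded) ('k::zero, 'n) weyl = "UNIV :: ('n mindex \<Rightarrow> ('k, 'n) mpoly) set"
  morphisms wcoeff Weyl
  by simp

lemma wcoeff_Weyl [simp]: "wcoeff (Weyl f) = f"
  by (simp add: Weyl_inverse)

lemma weyl_eqI: "(\<And>\<beta>. wcoeff a \<beta> = wcoeff b \<beta>) \<Longrightarrow> a = b"
  by (metis ext wcoeff_inverse)

instantiation weyl :: (ab_group_add, type) ab_group_add
begin

definition "0 = Weyl (\<lambda>_. 0)"
definition "a + b = Weyl (\<lambda>\<beta>. wcoeff a \<beta> + wcoeff b \<beta>)"
definition "a - b = Weyl (\<lambda>\<beta>. wcoeff a \<beta> - wcoeff b \<beta>)"
definition "- a = Weyl (\<lambda>\<beta>. - wcoeff a \<beta>)"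

instance
  by intro_classes
    (auto intro!: weyl_eqI
      simp: zero_weyl_def plus_weyl_def minus_weyl_def uminus_weyl_def algebra_simps)

end

lemma wcoeff_zero [simp]: "wcoeff 0 \<beta> = 0"
  and wcoeff_add [simp]: "wcoeff (a + b) \<beta> = wcoeff a \<beta> + wcoeff b \<beta>"
  and wcoeff_diff [simp]: "wcoeff (a - b) \<beta> = wcoeff a \<beta> - wcoeff b \<beta>"
  and wcoeff_uminus [simp]: "wcoeff (- a) \<beta> = - wcoeff a \<beta>"
  by (auto simp: zero_weyl_def plus_weyl_def minus_weyl_def uminus_weyl_def)

lemma wcoeff_sum: "wcoeff (sum f A) \<beta> = (\<Sum>i\<in>A. wcoeff (f i) \<beta>)"
  by (induction A rule: infinite_finite_induct) auto

text \<open>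
  The product is the bilinear, continuous extension of the commutation rule
  \<open>\<partial>\<^sup>\<beta> q = \<Sum>\<^bsub>\<epsilon> + \<kappa> = \<beta>\<^esub> (\<beta> choose \<epsilon>) (\<partial>\<^sup>\<kappa> q) \<partial>\<^sup>\<epsilon>\<close>, that is of \<open>[\<partial>\<^sub>\<mu>, x\<^sub>\<nu>] = \<delta>\<^sub>\<mu>\<^sub>\<nu>\<close>. Each coefficient
  is a finite sum because \<open>\<partial>\<^sup>\<kappa> q = 0\<close> for all but finitely many \<open>\<kappa>\<close>.
\<close>

instantiation weyl :: (comm_ring_1, finite) "{one, times}"
begin

definition "1 = Weyl (\<lambda>\<beta>. if \<beta> = 0 then 1 else 0)"
definition "a * b = Weyl (\<lambda>\<delta>. \<Sum>(\<epsilon>, \<gamma>)\<in>splits \<delta>. \<Sum>\<kappa>\<in>mderiv_supp (wcoeff b \<gamma>).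
    of_nat (mbinom \<epsilon> \<kappa>) * wcoeff a (\<epsilon> + \<kappa>) * mderiv \<kappa> (wcoeff b \<gamma>))"

instance ..

end

definition wscale :: "'k::comm_ring_1 \<Rightarrow> ('k, 'n) weyl \<Rightarrow> ('k, 'n) weyl" where
  "wscale c a = Weyl (\<lambda>\<beta>. Const c * wcoeff a \<beta>)"

definition wx :: "'n \<Rightarrow> ('k::comm_ring_1, 'n) weyl" where
  "wx \<mu> = Weyl (\<lambda>\<beta>. if \<beta> = 0 then Var \<mu> else 0)"

definition wd :: "'n \<Rightarrow> ('k::comm_ring_1, 'n) weyl" where
  "wd \<mu> = Weyl (\<lambda>\<beta>. if \<beta> = unit_index \<mu> then 1 else 0)"

definition wact :: "('k::comm_ring_1, 'n::finite) weyl \<Rightarrow> ('k, 'n) mpoly \<Rightarrow> ('k, 'n) mpoly"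
    (infixr "\<rhd>" 69) where
  "a \<rhd> f = (\<Sum>\<beta>\<in>mderiv_supp f. wcoeff a \<beta> * mderiv \<beta> f)"

subsection \<open>Calculus of iterated derivatives\<close>

lemma finite_splits [simp]: "finite (splits (\<delta>::'n::finite mindex))"
proof -
  let ?B = "{\<epsilon>. \<forall>i. lookup \<epsilon> i \<le> lookup \<delta> i}"
  have "finite (lookup ` ?B)"
  proof (rule finite_subset)
    show "lookup ` ?B \<subseteq> (\<Pi>\<^sub>E i\<in>UNIV. {..lookup \<delta> i})" by auto
  qed (auto intro: finite_PiE)
  then have "finite ?B"
    by (rule finite_imageD) (simp add: inj_on_def poly_mapping.lookup_inject)
  then have "finite (?B \<times> ?B)" by simp
  moreover have "splits \<delta> \<subseteq> ?B \<times> ?B"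
    by (auto simp: splits_def lookup_add)
  ultimately show ?thesis by (rule finite_subset[rotated])
qed

lemma lookup_Const_mult [simp]: "lookup (Const c * p) \<alpha> = c * lookup p \<alpha>"
  for p :: "('k::comm_semiring_1, 'n) mpoly"
proof -
  have "lookup (Poly_Mapping.map ((*) c) p) \<alpha> = c * lookup p \<alpha>"
    by transfer (auto simp: when_def)
  then show ?thesis
    by (simp add: mult_map_scale_conv_mult Const_def)
qed

lemma of_nat_eq_Const: "(of_nat m :: ('k::comm_semiring_1, 'n) mpoly) = Const (of_nat m)"
  by (simp add: Const_def)

lemma lookup_of_nat_mult [simp]:
  "lookup (of_nat m * (p :: ('k::comm_semiring_1, 'n) mpoly)) \<alpha> = of_nat m * lookup p \<alpha>"
  by (simp only: of_nat_eq_Const lookup_Const_mult)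

lemma Const_0 [simp]: "Const 0 = 0"
  and Const_1 [simp]: "Const 1 = (1 :: ('k::comm_semiring_1, 'n) mpoly)"
  and Const_add: "Const (a + b) = (Const a + Const b :: ('k, 'n) mpoly)"
  and Const_mult: "Const (a * b) = (Const a * Const b :: ('k, 'n) mpoly)"
  by (simp_all add: Const_def single_add mult_single)

lemma mpoch_0 [simp]: "mpoch \<alpha> 0 = 1"
  by (simp add: mpoch_def)

lemma mpoch_add: "mpoch \<alpha> (\<kappa> + \<epsilon>) = mpoch \<alpha> \<kappa> * mpoch (\<alpha> + \<kappa>) \<epsilon>"
  by (simp add: mpoch_def lookup_add pochhammer_product' flip: prod.distrib)

lemma mpoch_unit [simp]: "mpoch \<alpha> (unit_index \<mu>) = Suc (lookup \<alpha> \<mu>)"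
proof -
  have "mpoch \<alpha> (unit_index \<mu>) = (\<Prod>i\<in>UNIV. if i = \<mu> then Suc (lookup \<alpha> \<mu>) else 1)"
    unfolding mpoch_def by (intro prod.cong) (auto simp: lookup_single when_def)
  then show ?thesis by simp
qed

lemma mpoch_pos: "mpoch \<alpha> \<kappa> > 0"
  unfolding mpoch_def by (intro prod_pos) (auto simp: pochhammer_pos)

lemma lookup_mderiv: "lookup (mderiv \<kappa> p) \<alpha> = of_nat (mpoch \<alpha> \<kappa>) * lookup p (\<alpha> + \<kappa>)"
  by transfer simp

lemma mderiv_0 [simp]: "mderiv 0 p = p"
  and mderiv_zero [simp]: "mderiv \<kappa> 0 = 0"
  and mderiv_add: "mderiv \<kappa> (p + q) = mderiv \<kappa> p + mderiv \<kappa> q"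
  by (auto intro!: poly_mapping_eqI simp: lookup_mderiv lookup_add algebra_simps)

lemma mderiv_sum: "mderiv \<kappa> (sum f A) = (\<Sum>i\<in>A. mderiv \<kappa> (f i))"
  by (induction A rule: infinite_finite_induct) (auto simp: mderiv_add)

lemma mderiv_mderiv: "mderiv \<kappa> (mderiv \<epsilon> p) = mderiv (\<kappa> + \<epsilon>) p"
  by (rule poly_mapping_eqI) (simp add: lookup_mderiv mpoch_add mult.assoc add.assoc)

lemma mderiv_of_nat_mult: "mderiv \<kappa> (of_nat m * p) = of_nat m * mderiv \<kappa> p"
  by (rule poly_mapping_eqI) (simp add: lookup_mderiv mult.left_commute)

lemma poly_mapping_sum_single:
  fixes p :: "'a \<Rightarrow>\<^sub>0 'b::comm_monoid_add"
  shows "p = (\<Sum>\<alpha>\<in>Poly_Mapping.keys p. Poly_Mapping.single \<alpha> (lookup p \<alpha>))"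
proof (rule poly_mapping_eqI)
  fix \<beta>
  have "lookup (\<Sum>\<alpha>\<in>Poly_Mapping.keys p. Poly_Mapping.single \<alpha> (lookup p \<alpha>)) \<beta>
      = (\<Sum>\<alpha>\<in>Poly_Mapping.keys p. if \<alpha> = \<beta> then lookup p \<beta> else 0)"
    unfolding lookup_sum by (intro sum.cong) (auto simp: lookup_single when_def)
  then show "lookup p \<beta> = lookup (\<Sum>\<alpha>\<in>Poly_Mapping.keys p. Poly_Mapping.single \<alpha> (lookup p \<alpha>)) \<beta>"
    by (simp add: in_keys_iff)
qed

lemma finite_mderiv_supp [simp]: "finite (mderiv_supp p)"
proof -
  have "mderiv_supp p \<subseteq> (\<Union>\<alpha>\<in>Poly_Mapping.keys p. snd ` splits \<alpha>)"
  proof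
    fix \<kappa> assume "\<kappa> \<in> mderiv_supp p"
    then obtain \<alpha> where "lookup (mderiv \<kappa> p) \<alpha> \<noteq> 0"
      unfolding mderiv_supp_def by (metis (mono_tags) lookup_zero mem_Collect_eq poly_mapping_eqI)
    then have "\<alpha> + \<kappa> \<in> Poly_Mapping.keys p" by (auto simp: lookup_mderiv in_keys_iff)
    moreover have "\<kappa> \<in> snd ` splits (\<alpha> + \<kappa>)"
      by (force simp: splits_def)
    ultimately show "\<kappa> \<in> (\<Union>\<alpha>\<in>Poly_Mapping.keys p. snd ` splits \<alpha>)" by blast
  qed
  then show ?thesis by (rule finite_subset) auto
qed

lemma unit_le_decomp: "lookup \<alpha> \<mu> \<noteq> 0 \<Longrightarrow> \<alpha> = (\<alpha> - unit_index \<mu>) + unit_index \<mu>"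
  for \<alpha> :: "'n mindex"
  by (rule poly_mapping_eqI) (auto simp: lookup_add lookup_minus lookup_single when_def)

lemma unit_le_decomp': "lookup \<alpha> \<mu> > 0 \<Longrightarrow> unit_index \<mu> + (\<alpha> - unit_index \<mu>) = \<alpha>"
  for \<alpha> :: "'n mindex"
  using unit_le_decomp[of \<alpha> \<mu>] by (simp add: add.commute)

lemma mderiv_unit_single:
  "mderiv (unit_index \<mu>) (Poly_Mapping.single \<alpha> c)
     = Poly_Mapping.single (\<alpha> - unit_index \<mu>) (of_nat (lookup \<alpha> \<mu>) * c)"
proof (rule poly_mapping_eqI)
  fix \<beta>
  show "lookup (mderiv (unit_index \<mu>) (Poly_Mapping.single \<alpha> c)) \<beta>
      = lookup (Poly_Mapping.single (\<alpha> - unit_index \<mu>) (of_nat (lookup \<alpha> \<mu>) * c)) \<beta>"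
  proof (cases "\<alpha> = \<beta> + unit_index \<mu>")
    case True
    then show ?thesis by (simp add: lookup_mderiv lookup_add)
  next
    case False
    then have "lookup \<alpha> \<mu> = 0 \<or> \<alpha> - unit_index \<mu> \<noteq> \<beta>"
      using unit_le_decomp[of \<alpha> \<mu>] by auto
    with False show ?thesis
      by (auto simp: lookup_mderiv lookup_single when_def)
  qed
qed

lemma mderiv_unit_mult:
  fixes p q :: "('k::comm_semiring_1, 'n::finite) mpoly"
  shows "mderiv (unit_index \<mu>) (p * q)
    = mderiv (unit_index \<mu>) p * q + p * mderiv (unit_index \<mu>) q"
proof -
  let ?D = "mderiv (unit_index \<mu>) :: ('k, 'n) mpoly \<Rightarrow> ('k, 'n) mpoly"
  have mono: "?D (Poly_Mapping.single \<alpha> c * Poly_Mapping.single \<beta> d)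
      = ?D (Poly_Mapping.single \<alpha> c) * Poly_Mapping.single \<beta> d
      + Poly_Mapping.single \<alpha> c * ?D (Poly_Mapping.single \<beta> d)" for \<alpha> \<beta> c d
  proof -
    let ?u = "unit_index \<mu>"
    have 1: "?D (Poly_Mapping.single \<alpha> c) * Poly_Mapping.single \<beta> d
        = Poly_Mapping.single (\<alpha> + \<beta> - ?u) (of_nat (lookup \<alpha> \<mu>) * c * d)"
    proof (cases "lookup \<alpha> \<mu> = 0")
      case False
      have "\<alpha> + \<beta> = (\<alpha> - ?u + \<beta>) + ?u"
        using unit_le_decomp[OF False] by (metis add.commute add.left_commute)
      then have "\<alpha> + \<beta> - ?u = \<alpha> - ?u + \<beta>"
        by (metis add_diff_cancel_right')
      then show ?thesis by (simp only: mderiv_unit_single mult_single)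
    qed (simp add: mderiv_unit_single)
    have 2: "Poly_Mapping.single \<alpha> c * ?D (Poly_Mapping.single \<beta> d)
        = Poly_Mapping.single (\<alpha> + \<beta> - ?u) (c * (of_nat (lookup \<beta> \<mu>) * d))"
    proof (cases "lookup \<beta> \<mu> = 0")
      case False
      have "\<alpha> + \<beta> = (\<alpha> + (\<beta> - ?u)) + ?u"
        using unit_le_decomp[OF False] by (metis add.assoc)
      then have "\<alpha> + \<beta> - ?u = \<alpha> + (\<beta> - ?u)"
        by (metis add_diff_cancel_right')
      then show ?thesis by (simp only: mderiv_unit_single mult_single)
    qed (simp add: mderiv_unit_single)
    show ?thesis
      unfolding 1 2
      by (simp add: mult_single mderiv_unit_single lookup_add algebra_simps flip: single_add)
  qed
  have "?D ((\<Sum>\<alpha>\<in>A. Poly_Mapping.single \<alpha> (f \<alpha>)) * (\<Sum>\<beta>\<in>B. Poly_Mapping.single \<beta> (g \<beta>)))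
      = ?D (\<Sum>\<alpha>\<in>A. Poly_Mapping.single \<alpha> (f \<alpha>)) * (\<Sum>\<beta>\<in>B. Poly_Mapping.single \<beta> (g \<beta>))
      + (\<Sum>\<alpha>\<in>A. Poly_Mapping.single \<alpha> (f \<alpha>)) * ?D (\<Sum>\<beta>\<in>B. Poly_Mapping.single \<beta> (g \<beta>))" for A B f g
    by (simp add: sum_product mderiv_sum mono sum.distrib)
  from this[of "lookup p" "Poly_Mapping.keys p" "lookup q" "Poly_Mapping.keys q"] show ?thesis
    by (simp flip: poly_mapping_sum_single)
qed

lemma mbinom_0 [simp]: "mbinom 0 \<kappa> = 1" "mbinom \<kappa> 0 = 1"
  by (simp_all add: mbinom_def)

lemma mbinom_step:
  assumes "lookup (\<epsilon> + \<eta>) \<mu> \<noteq> 0"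
  shows "mbinom \<epsilon> \<eta> = (if lookup \<epsilon> \<mu> = 0 then 0 else mbinom (\<epsilon> - unit_index \<mu>) \<eta>)
    + (if lookup \<eta> \<mu> = 0 then 0 else mbinom \<epsilon> (\<eta> - unit_index \<mu>))"
proof -
  let ?u = "unit_index \<mu>"
  define R where "R = (\<Prod>i\<in>UNIV - {\<mu>}. (lookup \<epsilon> i + lookup \<eta> i) choose lookup \<epsilon> i)"
  have split: "mbinom \<epsilon>' \<eta>' = ((lookup \<epsilon>' \<mu> + lookup \<eta>' \<mu>) choose lookup \<epsilon>' \<mu>)
      * (\<Prod>i\<in>UNIV - {\<mu>}. (lookup \<epsilon>' i + lookup \<eta>' i) choose lookup \<epsilon>' i)" for \<epsilon>' \<eta>' :: "'a mindex"
    unfolding mbinom_def by (rule prod.remove) auto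
  have A: "mbinom \<epsilon> \<eta> = ((lookup \<epsilon> \<mu> + lookup \<eta> \<mu>) choose lookup \<epsilon> \<mu>) * R"
    unfolding split R_def ..
  have B: "mbinom (\<epsilon> - ?u) \<eta> = ((lookup \<epsilon> \<mu> - 1 + lookup \<eta> \<mu>) choose (lookup \<epsilon> \<mu> - 1)) * R"
    unfolding split R_def
    by (intro arg_cong2[where f = "(*)"] prod.cong) (auto simp: lookup_minus lookup_single when_def)
  have C: "mbinom \<epsilon> (\<eta> - ?u) = ((lookup \<epsilon> \<mu> + (lookup \<eta> \<mu> - 1)) choose lookup \<epsilon> \<mu>) * R"
    unfolding split R_def
    by (intro arg_cong2[where f = "(*)"] prod.cong) (auto simp: lookup_minus lookup_single when_def)
  show ?thesis
    using assms unfolding A B C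
    by (cases "lookup \<epsilon> \<mu>"; cases "lookup \<eta> \<mu>") (auto simp: lookup_add algebra_simps)
qed

lemma mindex_induct [case_names zero step]:
  fixes \<kappa> :: "'n::finite mindex"
  assumes "P 0" and step: "\<And>\<kappa> \<mu>. P \<kappa> \<Longrightarrow> P (\<kappa> + unit_index \<mu>)"
  shows "P \<kappa>"
proof (induction "\<Sum>i\<in>UNIV. lookup \<kappa> i" arbitrary: \<kappa>)
  case 0
  then have "\<kappa> = 0" by (intro poly_mapping_eqI) auto
  with assms show ?case by simp
next
  case (Suc m)
  then obtain \<mu> where \<mu>: "lookup \<kappa> \<mu> \<noteq> 0"
    by (metis Zero_not_Suc sum.neutral)
  have eq: "\<kappa> = (\<kappa> - unit_index \<mu>) + unit_index \<mu>"
    using unit_le_decomp[OF \<mu>] .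
  have "(\<Sum>i\<in>UNIV. lookup \<kappa> i) = (\<Sum>i\<in>UNIV. lookup (\<kappa> - unit_index \<mu>) i) + 1"
  proof -
    have "(\<Sum>i\<in>UNIV. lookup (\<kappa>' + unit_index \<mu>) i) = (\<Sum>i\<in>UNIV. lookup \<kappa>' i) + 1" for \<kappa>'
      by (simp add: lookup_add sum.distrib lookup_single when_def)
    then show ?thesis using eq by metis
  qed
  with Suc have "m = (\<Sum>i\<in>UNIV. lookup (\<kappa> - unit_index \<mu>) i)" by simp
  from step[OF Suc(1)[OF this], of \<mu>] eq show ?case by simp
qed

lemma mderiv_mult:
  fixes p q :: "('k::comm_semiring_1, 'n::finite) mpoly"
  shows "mderiv \<kappa> (p * q)
    = (\<Sum>(\<epsilon>, \<eta>)\<in>splits \<kappa>. of_nat (mbinom \<epsilon> \<eta>) * mderiv \<epsilon> p * mderiv \<eta> q)"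
proof (induction \<kappa> rule: mindex_induct)
  case zero
  have "splits (0::'n mindex) = {(0, 0)}"
    by (auto simp: splits_def poly_mapping_eq_iff lookup_add fun_eq_iff)
  then show ?case by simp
next
  case (step \<kappa> \<mu>)
  let ?u = "unit_index \<mu>"
  let ?f = "\<lambda>\<epsilon> \<eta>. mderiv \<epsilon> p * mderiv \<eta> q"
  let ?S = "splits (\<kappa> + ?u)"
  have "mderiv (\<kappa> + ?u) (p * q) = mderiv ?u (mderiv \<kappa> (p * q))"
    by (simp add: mderiv_mderiv add.commute)
  also have "\<dots> = (\<Sum>(\<epsilon>, \<eta>)\<in>splits \<kappa>. of_nat (mbinom \<epsilon> \<eta>) * ?f (\<epsilon> + ?u) \<eta>)
      + (\<Sum>(\<epsilon>, \<eta>)\<in>splits \<kappa>. of_nat (mbinom \<epsilon> \<eta>) * ?f \<epsilon> (\<eta> + ?u))"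
    unfolding step mderiv_sum sum.distrib[symmetric]
    by (intro sum.cong refl)
      (auto simp: mderiv_of_nat_mult mderiv_unit_mult mderiv_mderiv mult.assoc distrib_left add.commute)
  also have "(\<Sum>(\<epsilon>, \<eta>)\<in>splits \<kappa>. of_nat (mbinom \<epsilon> \<eta>) * ?f (\<epsilon> + ?u) \<eta>)
      = (\<Sum>(\<epsilon>, \<eta>)\<in>{s \<in> ?S. lookup (fst s) \<mu> \<noteq> 0}. of_nat (mbinom (\<epsilon> - ?u) \<eta>) * ?f \<epsilon> \<eta>)"
  proof (rule sum.reindex_bij_witness[where i = "\<lambda>(\<epsilon>, \<eta>). (\<epsilon> - ?u, \<eta>)" and j = "\<lambda>(\<epsilon>, \<eta>). (\<epsilon> + ?u, \<eta>)"])
    show "(case s of (\<epsilon>, \<eta>) \<Rightarrow> (\<epsilon> - ?u, \<eta>)) \<in> splits \<kappa>" if "s \<in> {s \<in> ?S. lookup (fst s) \<mu> \<noteq> 0}" for s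
    proof -
      obtain \<epsilon> \<eta> where s: "s = (\<epsilon>, \<eta>)" by force
      with that have "\<epsilon> + \<eta> = \<kappa> + ?u" "lookup \<epsilon> \<mu> \<noteq> 0" by (auto simp: splits_def)
      moreover from this have "\<epsilon> = \<epsilon> - ?u + ?u" by (intro unit_le_decomp)
      ultimately have "(\<epsilon> - ?u) + \<eta> + ?u = \<kappa> + ?u" by (metis add.commute add.left_commute)
      then show ?thesis using s by (simp add: splits_def)
    qed
  qed (auto simp: splits_def lookup_add ac_simps unit_le_decomp')
  also have "\<dots> = (\<Sum>(\<epsilon>, \<eta>)\<in>?S. of_nat (if lookup \<epsilon> \<mu> = 0 then 0 else mbinom (\<epsilon> - ?u) \<eta>) * ?f \<epsilon> \<eta>)"
    by (rule sum.mono_neutral_cong_left) (auto split: if_splits)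
  also have "(\<Sum>(\<epsilon>, \<eta>)\<in>splits \<kappa>. of_nat (mbinom \<epsilon> \<eta>) * ?f \<epsilon> (\<eta> + ?u))
      = (\<Sum>(\<epsilon>, \<eta>)\<in>{s \<in> ?S. lookup (snd s) \<mu> \<noteq> 0}. of_nat (mbinom \<epsilon> (\<eta> - ?u)) * ?f \<epsilon> \<eta>)"
  proof (rule sum.reindex_bij_witness[where i = "\<lambda>(\<epsilon>, \<eta>). (\<epsilon>, \<eta> - ?u)" and j = "\<lambda>(\<epsilon>, \<eta>). (\<epsilon>, \<eta> + ?u)"])
    show "(case s of (\<epsilon>, \<eta>) \<Rightarrow> (\<epsilon>, \<eta> - ?u)) \<in> splits \<kappa>" if "s \<in> {s \<in> ?S. lookup (snd s) \<mu> \<noteq> 0}" for s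
    proof -
      obtain \<epsilon> \<eta> where s: "s = (\<epsilon>, \<eta>)" by force
      with that have "\<epsilon> + \<eta> = \<kappa> + ?u" "lookup \<eta> \<mu> \<noteq> 0" by (auto simp: splits_def)
      moreover from this have "\<eta> = \<eta> - ?u + ?u" by (intro unit_le_decomp)
      ultimately have "\<epsilon> + (\<eta> - ?u) + ?u = \<kappa> + ?u" by (metis add.assoc)
      then show ?thesis using s by (simp add: splits_def)
    qed
  qed (auto simp: splits_def lookup_add ac_simps unit_le_decomp')
  also have "\<dots> = (\<Sum>(\<epsilon>, \<eta>)\<in>?S. of_nat (if lookup \<eta> \<mu> = 0 then 0 else mbinom \<epsilon> (\<eta> - ?u)) * ?f \<epsilon> \<eta>)"
    by (rule sum.mono_neutral_cong_left) (auto split: if_splits)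
  also have "(\<Sum>(\<epsilon>, \<eta>)\<in>?S. of_nat (if lookup \<epsilon> \<mu> = 0 then 0 else mbinom (\<epsilon> - ?u) \<eta>) * ?f \<epsilon> \<eta>)
      + (\<Sum>(\<epsilon>, \<eta>)\<in>?S. of_nat (if lookup \<eta> \<mu> = 0 then 0 else mbinom \<epsilon> (\<eta> - ?u)) * ?f \<epsilon> \<eta>)
      = (\<Sum>(\<epsilon>, \<eta>)\<in>?S. of_nat (mbinom \<epsilon> \<eta>) * ?f \<epsilon> \<eta>)"
    unfolding sum.distrib[symmetric]
  proof (intro sum.cong refl)
    fix s assume "s \<in> ?S"
    obtain \<epsilon> \<eta> where s: "s = (\<epsilon>, \<eta>)" by force
    with \<open>s \<in> ?S\<close> have "lookup (\<epsilon> + \<eta>) \<mu> \<noteq> 0" by (simp add: splits_def lookup_add)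
    from mbinom_step[OF this]
    show "(case s of (\<epsilon>, \<eta>) \<Rightarrow> of_nat (if lookup \<epsilon> \<mu> = 0 then 0 else mbinom (\<epsilon> - ?u) \<eta>) * ?f \<epsilon> \<eta>)
        + (case s of (\<epsilon>, \<eta>) \<Rightarrow> of_nat (if lookup \<eta> \<mu> = 0 then 0 else mbinom \<epsilon> (\<eta> - ?u)) * ?f \<epsilon> \<eta>)
        = (case s of (\<epsilon>, \<eta>) \<Rightarrow> of_nat (mbinom \<epsilon> \<eta>) * ?f \<epsilon> \<eta>)"
      unfolding s by (simp only: prod.case distrib_right[symmetric] of_nat_add[symmetric])
  qed
  finally show ?case by (simp add: mult.assoc)
qed

subsection \<open>The action on polynomials and the ring structure\<close>

lemma wact_superset:
  assumes "finite A" "mderiv_supp f \<subseteq> A"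
  shows "a \<rhd> f = (\<Sum>\<beta>\<in>A. wcoeff a \<beta> * mderiv \<beta> f)"
  unfolding wact_def
  by (rule sum.mono_neutral_left) (use assms in \<open>auto simp: mderiv_supp_def\<close>)

lemma wact_add_left: "(a + b) \<rhd> f = a \<rhd> f + b \<rhd> f"
  and wact_diff_left: "(a - b) \<rhd> f = a \<rhd> f - b \<rhd> f"
  and wact_zero_left [simp]: "0 \<rhd> f = 0"
  by (auto simp: wact_def algebra_simps sum.distrib sum_subtractf)

lemma wact_add_right: "a \<rhd> (f + g) = a \<rhd> f + a \<rhd> g"
proof -
  let ?A = "mderiv_supp f \<union> mderiv_supp g \<union> mderiv_supp (f + g)"
  have "a \<rhd> h = (\<Sum>\<beta>\<in>?A. wcoeff a \<beta> * mderiv \<beta> h)" if "h \<in> {f, g, f + g}" for h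
    by (rule wact_superset) (use that in auto)
  then show ?thesis by (simp add: mderiv_add distrib_left sum.distrib)
qed

lemma wact_zero_right [simp]: "a \<rhd> 0 = 0"
  by (simp add: wact_def)

lemma wact_one [simp]: "1 \<rhd> f = f"
proof -
  have "1 \<rhd> f = (\<Sum>\<beta>\<in>insert 0 (mderiv_supp f). wcoeff 1 \<beta> * mderiv \<beta> f)"
    by (rule wact_superset) auto
  also have "\<dots> = (\<Sum>\<beta>\<in>insert 0 (mderiv_supp f). if \<beta> = 0 then f else 0)"
    by (intro sum.cong) (auto simp: one_weyl_def)
  finally show ?thesis by simp
qed

lemma wact_wx: "wx \<mu> \<rhd> f = Var \<mu> * f"
proof -
  have "wx \<mu> \<rhd> f = (\<Sum>\<beta>\<in>insert 0 (mderiv_supp f). wcoeff (wx \<mu>) \<beta> * mderiv \<beta> f)"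
    by (rule wact_superset) auto
  also have "\<dots> = (\<Sum>\<beta>\<in>insert 0 (mderiv_supp f). if \<beta> = 0 then Var \<mu> * f else 0)"
    by (intro sum.cong) (auto simp: wx_def)
  finally show ?thesis by simp
qed

lemma wact_wd: "wd \<mu> \<rhd> f = mderiv (unit_index \<mu>) f"
proof -
  let ?A = "insert (unit_index \<mu>) (mderiv_supp f)"
  have "wd \<mu> \<rhd> f = (\<Sum>\<beta>\<in>?A. wcoeff (wd \<mu>) \<beta> * mderiv \<beta> f)"
    by (rule wact_superset) auto
  also have "\<dots> = (\<Sum>\<beta>\<in>?A. if \<beta> = unit_index \<mu> then mderiv (unit_index \<mu>) f else 0)"
    by (intro sum.cong) (auto simp: wd_def)
  finally show ?thesis by simp
qed

lemma wact_mult: "(a * b) \<rhd> f = a \<rhd> (b \<rhd> f)"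
  for a b :: "('k::comm_ring_1, 'n::finite) weyl"
proof -
  define F where "F = mderiv_supp f"
  define K where "K = (\<Union>\<gamma>\<in>F. mderiv_supp (wcoeff b \<gamma>))"
  define g where "g = (\<lambda>\<epsilon> \<gamma> \<kappa>. of_nat (mbinom \<epsilon> \<kappa>) * wcoeff a (\<epsilon> + \<kappa>)
    * mderiv \<kappa> (wcoeff b \<gamma>) * mderiv (\<epsilon> + \<gamma>) f)"
  have finF: "finite F" and finK: "finite K"
    by (auto simp: F_def K_def)
  have F1: "\<epsilon> \<in> F" "\<gamma> \<in> F" if "\<epsilon> + \<gamma> \<in> F" for \<epsilon> \<gamma>
    using that mderiv_mderiv[of \<epsilon> \<gamma> f] mderiv_mderiv[of \<gamma> \<epsilon> f]
    by (auto simp: F_def mderiv_supp_def add.commute)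
  have F0: "mderiv \<beta> f = 0" if "\<beta> \<notin> F" for \<beta>
    using that by (simp add: F_def mderiv_supp_def)
  have sub: "mderiv_supp (wcoeff b \<gamma>) \<subseteq> K" if "\<gamma> \<in> F" for \<gamma>
    using that by (auto simp: K_def)

  have "(a * b) \<rhd> f = (\<Sum>\<delta>\<in>F. \<Sum>s\<in>splits \<delta>. \<Sum>\<kappa>\<in>K. g (fst s) (snd s) \<kappa>)"
    unfolding wact_def F_def[symmetric]
  proof (intro sum.cong refl)
    fix \<delta> assume \<delta>: "\<delta> \<in> F"
    have "wcoeff (a * b) \<delta> * mderiv \<delta> f = (\<Sum>s\<in>splits \<delta>. (\<Sum>\<kappa>\<in>mderiv_supp (wcoeff b (snd s)).
        of_nat (mbinom (fst s) \<kappa>) * wcoeff a (fst s + \<kappa>) * mderiv \<kappa> (wcoeff b (snd s))) * mderiv \<delta> f)"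
      by (simp add: times_weyl_def sum_distrib_right case_prod_unfold)
    also have "\<dots> = (\<Sum>s\<in>splits \<delta>. \<Sum>\<kappa>\<in>K. g (fst s) (snd s) \<kappa>)"
    proof (intro sum.cong refl)
      fix s assume "s \<in> splits \<delta>"
      then have s: "fst s + snd s = \<delta>" by (auto simp: splits_def)
      with \<delta> F1 have "snd s \<in> F" by blast
      then show "(\<Sum>\<kappa>\<in>mderiv_supp (wcoeff b (snd s)).
          of_nat (mbinom (fst s) \<kappa>) * wcoeff a (fst s + \<kappa>) * mderiv \<kappa> (wcoeff b (snd s))) * mderiv \<delta> f
          = (\<Sum>\<kappa>\<in>K. g (fst s) (snd s) \<kappa>)"
        unfolding sum_distrib_right g_def s
        by (intro sum.mono_neutral_left finK sub) (auto simp: mderiv_supp_def)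
    qed
    finally show "wcoeff (a * b) \<delta> * mderiv \<delta> f = (\<Sum>s\<in>splits \<delta>. \<Sum>\<kappa>\<in>K. g (fst s) (snd s) \<kappa>)" .
  qed
  also have "\<dots> = (\<Sum>(\<delta>, s)\<in>Sigma F splits. \<Sum>\<kappa>\<in>K. g (fst s) (snd s) \<kappa>)"
    by (rule sum.Sigma) (use finF in auto)
  also have "\<dots> = (\<Sum>s\<in>{s. fst s + snd s \<in> F}. \<Sum>\<kappa>\<in>K. g (fst s) (snd s) \<kappa>)"
    by (rule sum.reindex_bij_witness[where i = "\<lambda>s. (fst s + snd s, s)" and j = snd])
      (auto simp: splits_def)
  also have "\<dots> = (\<Sum>s\<in>F \<times> F. \<Sum>\<kappa>\<in>K. g (fst s) (snd s) \<kappa>)"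
  proof (rule sum.mono_neutral_left)
    show "{s. fst s + snd s \<in> F} \<subseteq> F \<times> F"
      by (auto dest: F1)
  qed (use finF in \<open>auto simp: g_def F0\<close>)
  also have "\<dots> = (\<Sum>\<epsilon>\<in>F. \<Sum>\<gamma>\<in>F. \<Sum>\<kappa>\<in>K. g \<epsilon> \<gamma> \<kappa>)"
    unfolding sum.cartesian_product'[of "\<lambda>s. \<Sum>\<kappa>\<in>K. g (fst s) (snd s) \<kappa>"] by simp
  finally have L: "(a * b) \<rhd> f = (\<Sum>\<epsilon>\<in>F. \<Sum>\<gamma>\<in>F. \<Sum>\<kappa>\<in>K. g \<epsilon> \<gamma> \<kappa>)" .

  define T where "T = mderiv_supp (b \<rhd> f) \<union> (\<lambda>(\<kappa>, \<epsilon>). \<kappa> + \<epsilon>) ` (K \<times> F)"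
  have finT: "finite T" using finK finF by (auto simp: T_def)
  have z: "g \<epsilon> \<gamma> \<kappa> = 0" if "\<gamma> \<in> F" "\<epsilon> \<notin> F \<or> \<kappa> \<notin> K" for \<epsilon> \<gamma> \<kappa>
  proof (cases "\<epsilon> \<in> F")
    case True
    with that sub have "\<kappa> \<notin> mderiv_supp (wcoeff b \<gamma>)" by auto
    then show ?thesis by (simp add: g_def mderiv_supp_def)
  next
    case False
    with F1 have "\<epsilon> + \<gamma> \<notin> F" by blast
    then show ?thesis by (simp add: g_def F0)
  qed
  have "a \<rhd> (b \<rhd> f) = (\<Sum>\<beta>\<in>T. wcoeff a \<beta> * mderiv \<beta> (b \<rhd> f))"
    by (rule wact_superset[OF finT]) (simp add: T_def)
  also have "\<dots> = (\<Sum>\<beta>\<in>T. \<Sum>\<gamma>\<in>F. \<Sum>s\<in>splits \<beta>. g (snd s) \<gamma> (fst s))"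
  proof (intro sum.cong refl)
    fix \<beta>
    have "wcoeff a \<beta> * mderiv \<beta> (b \<rhd> f) = (\<Sum>\<gamma>\<in>F. \<Sum>s\<in>splits \<beta>. wcoeff a \<beta> *
        (of_nat (mbinom (fst s) (snd s)) * mderiv (fst s) (wcoeff b \<gamma>) * mderiv (snd s) (mderiv \<gamma> f)))"
      by (simp add: wact_def F_def mderiv_sum mderiv_mult sum_distrib_left case_prod_unfold)
    also have "\<dots> = (\<Sum>\<gamma>\<in>F. \<Sum>s\<in>splits \<beta>. g (snd s) \<gamma> (fst s))"
    proof (intro sum.cong refl)
      fix \<gamma> s assume "s \<in> splits \<beta>"
      then have \<beta>: "\<beta> = snd s + fst s" by (auto simp: splits_def add.commute)
      have "mbinom (fst s) (snd s) = mbinom (snd s) (fst s)"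
        unfolding mbinom_def
        by (intro prod.cong refl) (metis add.commute add_diff_cancel_left' binomial_symmetric le_add1)
      then show "wcoeff a \<beta> * (of_nat (mbinom (fst s) (snd s)) * mderiv (fst s) (wcoeff b \<gamma>)
          * mderiv (snd s) (mderiv \<gamma> f)) = g (snd s) \<gamma> (fst s)"
        by (simp add: g_def \<beta> mderiv_mderiv mult_ac)
    qed
    finally show "wcoeff a \<beta> * mderiv \<beta> (b \<rhd> f) = (\<Sum>\<gamma>\<in>F. \<Sum>s\<in>splits \<beta>. g (snd s) \<gamma> (fst s))" .
  qed
  also have "\<dots> = (\<Sum>\<gamma>\<in>F. \<Sum>\<beta>\<in>T. \<Sum>s\<in>splits \<beta>. g (snd s) \<gamma> (fst s))"
    by (rule sum.swap)
  also have "\<dots> = (\<Sum>\<gamma>\<in>F. \<Sum>(\<beta>, s)\<in>Sigma T splits. g (snd s) \<gamma> (fst s))"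
    by (intro sum.cong refl sum.Sigma) (use finT in auto)
  also have "\<dots> = (\<Sum>\<gamma>\<in>F. \<Sum>s\<in>{s. fst s + snd s \<in> T}. g (snd s) \<gamma> (fst s))"
    by (intro sum.cong refl sum.reindex_bij_witness[where i = "\<lambda>s. (fst s + snd s, s)" and j = snd])
      (auto simp: splits_def)
  also have "\<dots> = (\<Sum>\<gamma>\<in>F. \<Sum>s\<in>K \<times> F. g (snd s) \<gamma> (fst s))"
  proof (rule sum.cong[OF refl], rule sum.mono_neutral_right)
    have "{s. fst s + snd s \<in> T} = (\<Union>\<beta>\<in>T. splits \<beta>)" by (auto simp: splits_def)
    then show "finite {s. fst s + snd s \<in> T}" using finT by simp
    show "K \<times> F \<subseteq> {s. fst s + snd s \<in> T}" by (auto simp: T_def)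
  qed (use z in force)
  also have "\<dots> = (\<Sum>\<gamma>\<in>F. \<Sum>\<kappa>\<in>K. \<Sum>\<epsilon>\<in>F. g \<epsilon> \<gamma> \<kappa>)"
    by (simp add: sum.cartesian_product case_prod_unfold)
  also have "\<dots> = (\<Sum>\<gamma>\<in>F. \<Sum>\<epsilon>\<in>F. \<Sum>\<kappa>\<in>K. g \<epsilon> \<gamma> \<kappa>)"
    by (intro sum.cong refl sum.swap)
  also have "\<dots> = (\<Sum>\<epsilon>\<in>F. \<Sum>\<gamma>\<in>F. \<Sum>\<kappa>\<in>K. g \<epsilon> \<gamma> \<kappa>)"
    by (rule sum.swap)
  finally show ?thesis using L by simp
qed

lemma wact_faithful:
  fixes a b :: "('k::field_char_0, 'n::finite) weyl"
  assumes "\<And>f. a \<rhd> f = b \<rhd> f"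
  shows "a = b"
proof -
  define c where "c = a - b"
  have c0: "c \<rhd> f = 0" for f
    by (simp add: c_def wact_diff_left assms)
  have "wcoeff c \<beta> = 0" for \<beta>
  proof (induction "\<Sum>i\<in>UNIV. lookup \<beta> i" arbitrary: \<beta> rule: less_induct)
    case less
    let ?m = "Poly_Mapping.single \<beta> 1 :: ('k, 'n) mpoly"
    let ?A = "insert \<beta> (mderiv_supp ?m)"
    have "0 = c \<rhd> ?m"
      by (simp only: c0)
    also have "\<dots> = (\<Sum>\<gamma>\<in>?A. wcoeff c \<gamma> * mderiv \<gamma> ?m)"
      by (rule wact_superset) auto
    also have "\<dots> = (\<Sum>\<gamma>\<in>?A. if \<gamma> = \<beta> then wcoeff c \<beta> * mderiv \<beta> ?m else 0)"
    proof (intro sum.cong refl)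
      fix \<gamma> assume "\<gamma> \<in> ?A"
      show "wcoeff c \<gamma> * mderiv \<gamma> ?m = (if \<gamma> = \<beta> then wcoeff c \<beta> * mderiv \<beta> ?m else 0)"
      proof (cases "\<gamma> = \<beta> \<or> mderiv \<gamma> ?m = 0")
        case False
        then obtain \<alpha> where "lookup (mderiv \<gamma> ?m) \<alpha> \<noteq> 0"
          by (metis lookup_zero poly_mapping_eqI)
        then have \<beta>: "\<beta> = \<alpha> + \<gamma>"
          by (auto simp: lookup_mderiv lookup_single when_def split: if_splits)
        with False have "\<alpha> \<noteq> 0" by auto
        then obtain i where "lookup \<alpha> i \<noteq> 0" by (metis lookup_zero poly_mapping_eqI)
        then have "(\<Sum>i\<in>UNIV. lookup \<alpha> i) \<noteq> 0" by auto
        then have "(\<Sum>i\<in>UNIV. lookup \<gamma> i) < (\<Sum>i\<in>UNIV. lookup \<beta> i)"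
          unfolding \<beta> lookup_add sum.distrib by linarith
        with less have "wcoeff c \<gamma> = 0" by blast
        with False show ?thesis by simp
      qed auto
    qed
    also have "\<dots> = wcoeff c \<beta> * mderiv \<beta> ?m" by simp
    also have "mderiv \<beta> ?m = of_nat (mpoch 0 \<beta>)"
    proof (rule poly_mapping_eqI)
      fix \<alpha>
      have "\<beta> = \<alpha> + \<beta> \<longleftrightarrow> \<alpha> = 0" by (metis add_cancel_left_left)
      then show "lookup (mderiv \<beta> ?m) \<alpha> = lookup (of_nat (mpoch 0 \<beta>)) \<alpha>"
        by (auto simp: lookup_mderiv lookup_single when_def lookup_of_nat)
    qed
    finally have "of_nat (mpoch 0 \<beta>) * wcoeff c \<beta> = 0" by (simp add: mult.commute)
    then have "of_nat (mpoch 0 \<beta>) * lookup (wcoeff c \<beta>) \<alpha> = 0" for \<alpha>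
      by (metis lookup_of_nat_mult lookup_zero)
    then show ?case
      using mpoch_pos[of 0 \<beta>] by (intro poly_mapping_eqI) auto
  qed
  then have "c = 0" by (intro weyl_eqI) simp
  then show ?thesis by (simp add: c_def)
qed

instance weyl :: (field_char_0, finite) ring_1
proof
  fix a b c :: "('a, 'b) weyl"
  show "a * b * c = a * (b * c)"
    by (rule wact_faithful) (simp add: wact_mult)
  show "1 * a = a" "a * 1 = a"
    by (rule wact_faithful, simp add: wact_mult)+
  show "(a + b) * c = a * c + b * c" "a * (b + c) = a * b + a * c"
    by (rule wact_faithful, simp add: wact_mult wact_add_left wact_add_right)+
  have "wcoeff (0 :: ('a, 'b) weyl) 0 \<noteq> wcoeff 1 0" by (simp add: one_weyl_def)
  then show "(0 :: ('a, 'b) weyl) \<noteq> 1" by metis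
qed

lemma wx_wx_commute: "wx \<mu> * wx \<nu> = (wx \<nu> * wx \<mu> :: ('k::field_char_0, 'n::finite) weyl)"
  by (rule wact_faithful) (simp add: wact_mult wact_wx mult_ac)

lemma wd_wd_commute: "wd \<mu> * wd \<nu> = (wd \<nu> * wd \<mu> :: ('k::field_char_0, 'n::finite) weyl)"
  by (rule wact_faithful) (simp add: wact_mult wact_wd mderiv_mderiv add.commute)

lemma wd_wx_commutator:
  "wd \<mu> * wx \<nu> - wx \<nu> * wd \<mu> = (if \<mu> = \<nu> then 1 else 0 :: ('k::field_char_0, 'n::finite) weyl)"
proof (rule wact_faithful)
  fix f :: "('k, 'n) mpoly"
  have "mderiv (unit_index \<mu>) (Var \<nu>) = (if \<mu> = \<nu> then 1 else 0 :: ('k, 'n) mpoly)"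
    unfolding Var_def mderiv_unit_single by (auto simp: lookup_single when_def)
  then show "(wd \<mu> * wx \<nu> - wx \<nu> * wd \<mu>) \<rhd> f = (if \<mu> = \<nu> then 1 else 0) \<rhd> f"
    by (simp add: wact_diff_left wact_mult wact_wx wact_wd mderiv_unit_mult)
qed

lemma wcoeff_wscale [simp]: "wcoeff (wscale c a) \<beta> = Const c * wcoeff a \<beta>"
  by (simp add: wscale_def)

lemma vector_space_wscale:
  "vector_space (wscale :: 'k \<Rightarrow> ('k::field_char_0, 'n) weyl \<Rightarrow> ('k, 'n) weyl)"
  by unfold_locales (auto intro!: weyl_eqI simp: Const_add Const_mult algebra_simps)

lemma wact_wscale: "wscale c a \<rhd> f = Const c * (a \<rhd> f)"
  by (simp add: wact_def sum_distrib_left mult.assoc)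

lemma wact_Const_mult: "a \<rhd> (Const c * f) = Const c * (a \<rhd> f)"
proof -
  have D: "mderiv \<kappa> (Const c * f) = Const c * mderiv \<kappa> f" for \<kappa>
    by (rule poly_mapping_eqI) (simp add: lookup_mderiv mult.left_commute)
  let ?A = "mderiv_supp f \<union> mderiv_supp (Const c * f)"
  have "a \<rhd> h = (\<Sum>\<beta>\<in>?A. wcoeff a \<beta> * mderiv \<beta> h)" if "h \<in> {f, Const c * f}" for h
    by (rule wact_superset) (use that in auto)
  then show ?thesis by (simp add: D sum_distrib_left mult.left_commute)
qed

lemma wscale_mult:
  fixes a b :: "('k::field_char_0, 'n::finite) weyl"
  shows "wscale c a * b = wscale c (a * b)" "a * wscale c b = wscale c (a * b)"
  by (rule wact_faithful, simp add: wact_mult wact_wscale wact_Const_mult)+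

section \<open>Infinite sums and power series of matrices\<close>

text \<open>
  Convergence for the filtration by the order of differential operators: for every \<open>d\<close>, the partial
  sums eventually agree with the limit in all coefficients of order less than \<open>d\<close>.
\<close>

definition weyl_sums :: "(nat \<Rightarrow> ('k::ab_group_add, 'n::finite) weyl) \<Rightarrow> ('k, 'n) weyl \<Rightarrow> bool"
    (infixr "weyl'_sums" 80) where
  "f weyl_sums s \<longleftrightarrow> (\<forall>d::nat. \<forall>\<^sub>F N in sequentially. \<forall>\<beta>.
     (\<Sum>i\<in>UNIV. lookup \<beta> i) < d \<longrightarrow> wcoeff (\<Sum>k<N. f k) \<beta> = wcoeff s \<beta>)"

definition weyl_suminf :: "(nat \<Rightarrow> ('k::ab_group_add, 'n::finite) weyl) \<Rightarrow> ('k, 'n) weyl" where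
  "weyl_suminf f = (THE s. f weyl_sums s)"

lemma weyl_sums_unique:
  fixes s :: "('k::ab_group_add, 'n::finite) weyl"
  assumes "f weyl_sums s"
  shows "weyl_suminf f = s"
  unfolding weyl_suminf_def
proof (rule the_equality, rule assms)
  fix t assume t: "f weyl_sums t"
  show "t = s"
  proof (rule weyl_eqI)
    fix \<beta> :: "'n mindex"
    let ?d = "Suc (\<Sum>i\<in>UNIV. lookup \<beta> i)"
    have ev: "\<forall>\<^sub>F N in sequentially. wcoeff (\<Sum>k<N. f k) \<beta> = wcoeff u \<beta>" if "f weyl_sums u" for u
    proof -
      have "\<forall>\<^sub>F N in sequentially. \<forall>\<beta>. (\<Sum>i\<in>UNIV. lookup \<beta> i) < ?d
          \<longrightarrow> wcoeff (\<Sum>k<N. f k) \<beta> = wcoeff u \<beta>"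
        using that unfolding weyl_sums_def by blast
      then show ?thesis by (rule eventually_mono) simp
    qed
    have "\<forall>\<^sub>F N in sequentially. wcoeff t \<beta> = wcoeff s \<beta>"
      using ev[OF t] ev[OF assms] by eventually_elim simp
    then show "wcoeff t \<beta> = wcoeff s \<beta>" by simp
  qed
qed

primrec matpow :: "'a::semiring_1 ^ 'n ^ 'n \<Rightarrow> nat \<Rightarrow> 'a ^ 'n ^ 'n" where
  "matpow M 0 = mat 1"
| "matpow M (Suc k) = M ** matpow M k"

definition fps_matrix ::
  "'k fps \<Rightarrow> ('k::field_char_0, 'n::finite) weyl ^ 'n ^ 'n \<Rightarrow> ('k, 'n) weyl ^ 'n ^ 'n" where
  "fps_matrix F M = (\<chi> \<mu> \<alpha>. weyl_suminf (\<lambda>k. wscale (fps_nth F k) (matpow M k $ \<mu> $ \<alpha>)))"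

definition psi :: "'k::field_char_0 fps" where
  "psi = fps_X / (1 - fps_exp (- 1))"

lemma psi_mult: "psi * (1 - fps_exp (- 1)) = (fps_X :: 'k::field_char_0 fps)"
proof -
  have "fps_nth (1 - fps_exp (- 1) :: 'k fps) 1 \<noteq> 0" by simp
  then have "subdegree (1 - fps_exp (- 1) :: 'k fps) \<le> 1" "1 - fps_exp (- 1) \<noteq> (0 :: 'k fps)"
    by (auto intro: subdegree_leI simp del: fps_sub_nth)
  then have "1 - fps_exp (- 1) dvd (fps_X :: 'k fps)"
    by (simp add: fps_dvd_iff)
  then show ?thesis unfolding psi_def by simp
qed

fun bernoulli :: "nat \<Rightarrow> 'k::field_char_0" where
  "bernoulli n = (if n = 0 then 1
     else - (\<Sum>k<n. of_nat (Suc n choose k) * bernoulli k) / of_nat (Suc n))"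

declare bernoulli.simps [simp del]

lemma bernoulli_0: "bernoulli 0 = 1"
  and bernoulli_1: "bernoulli 1 = - 1 / 2"
  by (simp_all add: bernoulli.simps)

section \<open>Lie algebras and the Weyl realization\<close>

text \<open>
  The ground field is taken from the class \<^class>\<open>real_normed_field\<close>: by the theorems of Frobenius
  and Gelfand--Mazur, its instances are precisely the fields \<open>\<real>\<close> and \<open>\<complex>\<close>, up to isometric isomorphism.
  The algebraic notions below need less.
\<close>

locale lie_algebra = vector_space smul
  for smul :: "'k::field \<Rightarrow> 'g::ab_group_add \<Rightarrow> 'g" +
  fixes bracket :: "'g \<Rightarrow> 'g \<Rightarrow> 'g"
  assumes bracket_add_left: "bracket (x + y) z = bracket x z + bracket y z"
    and bracket_add_right: "bracket x (y + z) = bracket x y + bracket x z"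
    and bracket_scale_left: "bracket (smul c x) y = smul c (bracket x y)"
    and bracket_scale_right: "bracket x (smul c y) = smul c (bracket x y)"
    and bracket_self: "bracket x x = 0"
    and jacobi: "bracket x (bracket y z) + bracket y (bracket z x) + bracket z (bracket x y) = 0"

definition lie_algebra_hom ::
  "('k::field \<Rightarrow> 'g::ab_group_add \<Rightarrow> 'g) \<Rightarrow> ('g \<Rightarrow> 'g \<Rightarrow> 'g) \<Rightarrow>
   ('k \<Rightarrow> 'h::ab_group_add \<Rightarrow> 'h) \<Rightarrow> ('h \<Rightarrow> 'h \<Rightarrow> 'h) \<Rightarrow> ('g \<Rightarrow> 'h) \<Rightarrow> bool" where
  "lie_algebra_hom smul\<^sub>1 bracket\<^sub>1 smul\<^sub>2 bracket\<^sub>2 \<rho> \<longleftrightarrow>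
     Vector_Spaces.linear smul\<^sub>1 smul\<^sub>2 \<rho> \<and>
     (\<forall>x y. \<rho> (bracket\<^sub>1 x y) = bracket\<^sub>2 (\<rho> x) (\<rho> y))"

definition basis_family ::
  "('k::field \<Rightarrow> 'g::ab_group_add \<Rightarrow> 'g) \<Rightarrow> ('n \<Rightarrow> 'g) \<Rightarrow> bool" where
  "basis_family smul X \<longleftrightarrow>
     inj X \<and> \<not> module.dependent smul (range X) \<and> module.span smul (range X) = UNIV"

definition commutator :: "'a::ring \<Rightarrow> 'a \<Rightarrow> 'a" where
  "commutator a b = a * b - b * a"

lemma lie_algebra_weyl:
  "lie_algebra wscale (commutator :: ('k::field_char_0, 'n::finite) weyl \<Rightarrow> _)"
proof -
  interpret vector_space "wscale :: 'k \<Rightarrow> ('k, 'n) weyl \<Rightarrow> _"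
    by (rule vector_space_wscale)
  show ?thesis
    by unfold_locales
      (simp_all add: commutator_def distrib_left distrib_right left_diff_distrib right_diff_distrib
        mult.assoc wscale_mult scale_right_diff_distrib)
qed

definition structure_matrix ::
  "('n \<Rightarrow> 'n \<Rightarrow> 'n \<Rightarrow> 'k) \<Rightarrow> ('k::field_char_0, 'n::finite) weyl ^ 'n ^ 'n" where
  "structure_matrix c = (\<chi> \<mu> \<nu>. \<Sum>\<alpha>\<in>UNIV. wscale (c \<mu> \<alpha> \<nu>) (wd \<alpha>))"

definition xhat :: "('n \<Rightarrow> 'n \<Rightarrow> 'n \<Rightarrow> 'k) \<Rightarrow> 'n \<Rightarrow> ('k::field_char_0, 'n::finite) weyl" where
  "xhat c \<mu> = (\<Sum>\<alpha>\<in>UNIV. wx \<alpha> * fps_matrix psi (structure_matrix c) $ \<mu> $ \<alpha>)"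

end

theory Submission
  imports Defs
begin

text \<open>
  Write \<open>D = \<Sum>\<^sub>\<alpha> \<partial>\<^sub>\<alpha> X\<^sub>\<alpha>\<close>, so that the matrix \<open>\<^bold>C\<close>, acting on row vectors, is \<open>u \<mapsto> [u, D]\<close>. The rows
  \<open>\<Phi>\<^sub>\<alpha>\<close> of \<open>(1 - exp (- t \<^bold>C)) / \<^bold>C\<close> are the components of the right Maurer--Cartan form in exponential
  coordinates. They satisfy \<open>d\<Phi>\<^sub>\<alpha>/dt = e\<^sub>\<alpha> - [\<Phi>\<^sub>\<alpha>, D]\<close>, so by the Jacobi identity the defect
  \<open>F = \<partial>\<^sub>\<alpha> \<Phi>\<^sub>\<beta> - \<partial>\<^sub>\<beta> \<Phi>\<^sub>\<alpha> - [\<Phi>\<^sub>\<alpha>, \<Phi>\<^sub>\<beta>]\<close> (now \<open>\<partial>\<^sub>\<alpha>\<close> denotes differentiation by the symbol \<open>\<partial>\<^sub>\<alpha>\<close>) solves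
  \<open>dF/dt = - [F, D]\<close> with \<open>F(0) = 0\<close> and vanishes. Passing to the inverse matrix \<open>\<psi>(t \<^bold>C)/t\<close> and setting
  \<open>t = 1\<close> turns this structure equation into the commutation relations of the \<open>x\<^sub>\<mu>\<close> with hats, because
  the commutator with \<open>x\<^sub>\<beta>\<close> differentiates by \<open>\<partial>\<^sub>\<beta>\<close>. Symmetrization holds because, by skew-symmetry,
  every positive power of \<open>\<^bold>C\<close> contracted with \<open>k\<close> on the left annihilates the powers of \<open>k \<cdot> x\<close>.
\<close>

section \<open>Brackets given by structure constants\<close>

text \<open>The coefficients lie in an arbitrary commutative ring, so that the bracket extends from
  the ground field to vectors of power series in t with polynomial coefficients.\<close>

definition vbracket :: "('n \<Rightarrow> 'n \<Rightarrow> 'n \<Rightarrow> 'a) \<Rightarrow> 'a::comm_ring_1 ^ 'n::finite \<Rightarrow> 'a ^ 'n \<Rightarrow> 'a ^ 'n" where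
  "vbracket c u v = (\<chi> \<gamma>. \<Sum>\<mu>\<in>UNIV. \<Sum>\<nu>\<in>UNIV. u $ \<mu> * v $ \<nu> * c \<mu> \<nu> \<gamma>)"

definition lie_constants :: "('n::finite \<Rightarrow> 'n \<Rightarrow> 'n \<Rightarrow> 'a::comm_ring_1) \<Rightarrow> bool" where
  "lie_constants c \<longleftrightarrow>
     (\<forall>\<mu> \<nu> \<gamma>. c \<mu> \<nu> \<gamma> = - c \<nu> \<mu> \<gamma>) \<and>
     (\<forall>\<mu> \<nu> \<kappa> \<gamma>. (\<Sum>\<delta>\<in>UNIV. c \<mu> \<nu> \<delta> * c \<delta> \<kappa> \<gamma>) + (\<Sum>\<delta>\<in>UNIV. c \<nu> \<kappa> \<delta> * c \<delta> \<mu> \<gamma>)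
        + (\<Sum>\<delta>\<in>UNIV. c \<kappa> \<mu> \<delta> * c \<delta> \<nu> \<gamma>) = 0)"

lemma vbracket_add: "vbracket c (u + u') v = vbracket c u v + vbracket c u' v"
    "vbracket c u (v + v') = vbracket c u v + vbracket c u v'"
  and vbracket_diff: "vbracket c (u - u') v = vbracket c u v - vbracket c u' v"
    "vbracket c u (v - v') = vbracket c u v - vbracket c u v'"
  by (simp_all add: vec_eq_iff vbracket_def algebra_simps sum.distrib sum_subtractf)

lemma vbracket_scale: "vbracket c (a *s u) v = a *s vbracket c u v"
    "vbracket c u (a *s v) = a *s vbracket c u v"
  by (simp_all add: vec_eq_iff vbracket_def sum_distrib_left mult_ac)

lemma vbracket_zero: "vbracket c 0 v = 0" "vbracket c u 0 = 0"
  by (simp_all add: vec_eq_iff vbracket_def)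

lemma vbracket_sum: "vbracket c (\<Sum>i\<in>A. u i) v = (\<Sum>i\<in>A. vbracket c (u i) v)"
    "vbracket c v (\<Sum>i\<in>A. u i) = (\<Sum>i\<in>A. vbracket c v (u i))"
  by (induction A rule: infinite_finite_induct) (simp_all add: vbracket_add vbracket_zero)

lemma vbracket_axis: "vbracket c (axis \<mu> 1) (axis \<nu> 1) $ \<gamma> = c \<mu> \<nu> \<gamma>"
proof -
  have "vbracket c (axis \<mu> 1) (axis \<nu> 1) $ \<gamma>
      = (\<Sum>\<mu>'\<in>UNIV. \<Sum>\<nu>'\<in>UNIV. if \<nu>' = \<nu> then (if \<mu>' = \<mu> then c \<mu> \<nu> \<gamma> else 0) else 0)"
    by (simp only: vbracket_def vec_lambda_beta, intro sum.cong refl) (simp add: axis_def)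
  then show ?thesis by simp
qed

lemma vbracket_skew:
  assumes "lie_constants c"
  shows "vbracket c u v = - vbracket c v u"
proof (rule vec_eq_iff[THEN iffD2], rule allI)
  fix \<gamma>
  have "vbracket c u v $ \<gamma> = (\<Sum>\<nu>\<in>UNIV. \<Sum>\<mu>\<in>UNIV. u $ \<mu> * v $ \<nu> * c \<mu> \<nu> \<gamma>)"
    unfolding vbracket_def by (simp, rule sum.swap)
  also have "\<dots> = (\<Sum>\<nu>\<in>UNIV. \<Sum>\<mu>\<in>UNIV. - (v $ \<nu> * u $ \<mu> * c \<nu> \<mu> \<gamma>))"
    using assms unfolding lie_constants_def
    by (intro sum.cong refl) (metis mult.commute mult_minus_right)
  also have "\<dots> = (- vbracket c v u) $ \<gamma>"
    by (simp add: vbracket_def sum_negf)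
  finally show "vbracket c u v $ \<gamma> = (- vbracket c v u) $ \<gamma>" .
qed

text \<open>Collecting the structure constants of a double bracket into one coefficient reduces the
  Jacobi identity for vectors to the one in \<open>lie_constants\<close>.\<close>

lemma vbracket_nested:
  "vbracket c (vbracket c u v) w $ \<gamma> =
     (\<Sum>\<mu>\<in>UNIV. \<Sum>\<nu>\<in>UNIV. \<Sum>\<kappa>\<in>UNIV. u $ \<mu> * v $ \<nu> * w $ \<kappa> * (\<Sum>\<delta>\<in>UNIV. c \<mu> \<nu> \<delta> * c \<delta> \<kappa> \<gamma>))"
proof -
  have "vbracket c (vbracket c u v) w $ \<gamma>
      = (\<Sum>\<delta>\<in>UNIV. \<Sum>\<kappa>\<in>UNIV. \<Sum>\<mu>\<in>UNIV. \<Sum>\<nu>\<in>UNIV. u $ \<mu> * v $ \<nu> * w $ \<kappa> * (c \<mu> \<nu> \<delta> * c \<delta> \<kappa> \<gamma>))"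
    by (simp add: vbracket_def sum_distrib_left sum_distrib_right mult_ac)
  also have "\<dots> = (\<Sum>\<delta>\<in>UNIV. \<Sum>\<mu>\<in>UNIV. \<Sum>\<nu>\<in>UNIV. \<Sum>\<kappa>\<in>UNIV. u $ \<mu> * v $ \<nu> * w $ \<kappa> * (c \<mu> \<nu> \<delta> * c \<delta> \<kappa> \<gamma>))"
    by (subst (2) sum.swap) (subst (3) sum.swap, rule refl)
  also have "\<dots> = (\<Sum>\<mu>\<in>UNIV. \<Sum>\<nu>\<in>UNIV. \<Sum>\<kappa>\<in>UNIV. \<Sum>\<delta>\<in>UNIV. u $ \<mu> * v $ \<nu> * w $ \<kappa> * (c \<mu> \<nu> \<delta> * c \<delta> \<kappa> \<gamma>))"
    by (subst sum.swap, subst (2) sum.swap, subst (3) sum.swap, rule refl)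
  finally show ?thesis by (simp add: sum_distrib_left)
qed

text \<open>The Jacobi identity makes bracketing with \<open>w\<close> on the right a derivation.
  The Maurer-Cartan argument uses this with \<open>point\<close> for \<open>w\<close>.\<close>

lemma vbracket_derivation:
  assumes "lie_constants c"
  shows "vbracket c (vbracket c u v) w = vbracket c (vbracket c u w) v + vbracket c u (vbracket c v w)"
proof -
  define J where "J = (\<lambda>\<mu> \<nu> \<kappa> \<gamma>. \<Sum>\<delta>\<in>UNIV. c \<mu> \<nu> \<delta> * c \<delta> \<kappa> \<gamma>)"
  have nested: "vbracket c (vbracket c x y) z $ \<gamma> =
     (\<Sum>\<mu>\<in>UNIV. \<Sum>\<nu>\<in>UNIV. \<Sum>\<kappa>\<in>UNIV. x $ \<mu> * y $ \<nu> * z $ \<kappa> * J \<mu> \<nu> \<kappa> \<gamma>)" for x y z \<gamma>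
    unfolding J_def by (rule vbracket_nested)
  have sk: "J \<mu> \<nu> \<kappa> \<gamma> = - J \<nu> \<mu> \<kappa> \<gamma>" for \<mu> \<nu> \<kappa> \<gamma>
    using assms unfolding J_def lie_constants_def sum_negf[symmetric]
    by (intro sum.cong refl) (metis mult_minus_left)
  have jac: "J \<mu> \<nu> \<kappa> \<gamma> + J \<nu> \<kappa> \<mu> \<gamma> + J \<kappa> \<mu> \<nu> \<gamma> = 0" for \<mu> \<nu> \<kappa> \<gamma>
    using assms unfolding J_def lie_constants_def by blast
  \<comment> \<open>The coefficient form of the claim, once its last bracket has been flipped by
    skew-symmetry.\<close>
  have J: "J \<mu> \<kappa> \<nu> \<gamma> - J \<nu> \<kappa> \<mu> \<gamma> = J \<mu> \<nu> \<kappa> \<gamma>" for \<mu> \<nu> \<kappa> \<gamma>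
  proof -
    have "J \<mu> \<nu> \<kappa> \<gamma> = J \<mu> \<nu> \<kappa> \<gamma> - (J \<mu> \<nu> \<kappa> \<gamma> + J \<nu> \<kappa> \<mu> \<gamma> + J \<kappa> \<mu> \<nu> \<gamma>)"
      by (simp only: jac) simp
    also have "\<dots> = - J \<kappa> \<mu> \<nu> \<gamma> - J \<nu> \<kappa> \<mu> \<gamma>" by (simp only: algebra_simps) simp
    also have "- J \<kappa> \<mu> \<nu> \<gamma> = J \<mu> \<kappa> \<nu> \<gamma>" by (rule sk[symmetric])
    finally show ?thesis ..
  qed
  have "vbracket c (vbracket c u w) v $ \<gamma> - vbracket c (vbracket c v w) u $ \<gamma>
      = vbracket c (vbracket c u v) w $ \<gamma>" for \<gamma>
  proof -
    have "vbracket c (vbracket c u w) v $ \<gamma>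
      = (\<Sum>\<mu>\<in>UNIV. \<Sum>\<nu>\<in>UNIV. \<Sum>\<kappa>\<in>UNIV. u $ \<mu> * v $ \<nu> * w $ \<kappa> * J \<mu> \<kappa> \<nu> \<gamma>)"
      unfolding nested
      by (subst (2) sum.swap, intro sum.cong refl) (simp add: mult_ac)
    moreover have "vbracket c (vbracket c v w) u $ \<gamma>
      = (\<Sum>\<mu>\<in>UNIV. \<Sum>\<nu>\<in>UNIV. \<Sum>\<kappa>\<in>UNIV. u $ \<mu> * v $ \<nu> * w $ \<kappa> * J \<nu> \<kappa> \<mu> \<gamma>)"
      unfolding nested
      by (subst (2) sum.swap, subst sum.swap, intro sum.cong refl) (simp add: mult_ac)
    ultimately show ?thesis
      unfolding nested
      by (simp only: sum_subtractf[symmetric] right_diff_distrib[symmetric] J)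
  qed
  then have "vbracket c (vbracket c u w) v - vbracket c (vbracket c v w) u = vbracket c (vbracket c u v) w"
    by (simp add: vec_eq_iff)
  then show ?thesis
    using vbracket_skew[OF assms, of u "vbracket c v w"] by simp
qed

section \<open>The Maurer--Cartan equation for formal series\<close>

lemma mderiv_diff: "mderiv \<kappa> (p - q) = mderiv \<kappa> p - mderiv \<kappa> (q :: ('k::comm_ring_1, 'n::finite) mpoly)"
  using mderiv_add[of \<kappa> "p - q" q] by (simp add: algebra_simps)

lemma mderiv_Const_mult: "mderiv \<kappa> (Const c * p) = Const c * mderiv \<kappa> p"
  by (rule poly_mapping_eqI) (simp add: lookup_mderiv mult.left_commute)

lemma mderiv_unit_Const [simp]: "mderiv (unit_index \<mu>) (Const c) = 0"
  by (simp add: Const_def mderiv_unit_single)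

lemma mderiv_unit_Var [simp]: "mderiv (unit_index \<mu>) (Var \<nu>) = (if \<mu> = \<nu> then 1 else 0)"
  unfolding Var_def mderiv_unit_single by (auto simp: lookup_single when_def)

lemma mderiv_unit_one [simp]: "mderiv (unit_index \<mu>) 1 = 0"
  using mderiv_unit_Const[of \<mu> 1] by simp

lemma Const_sum: "Const (sum f A) = (\<Sum>i\<in>A. Const (f i) :: ('k::comm_semiring_1, 'n) mpoly)"
  by (induction A rule: infinite_finite_induct) (auto simp: Const_add)

lemma Const_uminus: "Const (- a) = - (Const a :: ('k::comm_ring_1, 'n) mpoly)"
  by (simp add: Const_def single_uminus)

lemma Const_of_nat: "Const (of_nat m) = (of_nat m :: ('k::comm_semiring_1, 'n) mpoly)"
  by (simp add: of_nat_eq_Const)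

section \<open>Power series in a matrix\<close>

lemma matpow_add: "matpow M (i + j) = matpow M i ** matpow M j"
  by (induction i) (simp_all add: matrix_mul_assoc)

lemma matpow_Suc_right: "matpow M (Suc k) = matpow M k ** M"
  using matpow_add[of M k 1] by simp

text \<open>This is F(t M). The formal variable t keeps the powers of M apart, so that infinite sums
  of them make sense over polynomials.\<close>

definition matrix_series ::
  "('k::field_char_0, 'n::finite) mpoly ^ 'n ^ 'n \<Rightarrow> 'k fps \<Rightarrow> ('k, 'n) mpoly fps ^ 'n ^ 'n" where
  "matrix_series M F = (\<chi> \<mu> \<alpha>. Abs_fps (\<lambda>k. Const (fps_nth F k) * matpow M k $ \<mu> $ \<alpha>))"

lemma matrix_series_nth [simp]:
  "fps_nth (matrix_series M F $ \<mu> $ \<alpha>) k = Const (fps_nth F k) * matpow M k $ \<mu> $ \<alpha>"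
  by (simp add: matrix_series_def)

lemma matrix_series_one: "matrix_series M 1 = mat 1"
  by (simp add: vec_eq_iff fps_eq_iff mat_def)

text \<open>Powers of a single matrix multiply by adding exponents, so substituting t M respects
  products. Inverse power series thus give inverse matrices.\<close>

lemma matrix_series_mult: "matrix_series M (F * G) = matrix_series M F ** matrix_series M G"
proof -
  have "fps_nth (matrix_series M (F * G) $ \<mu> $ \<alpha>) k
      = fps_nth ((matrix_series M F ** matrix_series M G) $ \<mu> $ \<alpha>) k" for \<mu> \<alpha> k
  proof -
    have "fps_nth (matrix_series M (F * G) $ \<mu> $ \<alpha>) k
        = (\<Sum>i=0..k. Const (fps_nth F i) * Const (fps_nth G (k - i))
            * (\<Sum>\<beta>\<in>UNIV. matpow M i $ \<mu> $ \<beta> * matpow M (k - i) $ \<beta> $ \<alpha>))"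
      unfolding matrix_series_nth fps_mult_nth Const_sum sum_distrib_right
    proof (intro sum.cong refl)
      fix i assume "i \<in> {0..k}"
      then have "matpow M k = matpow M i ** matpow M (k - i)"
        by (simp flip: matpow_add)
      then show "Const (fps_nth F i * fps_nth G (k - i)) * matpow M k $ \<mu> $ \<alpha>
          = Const (fps_nth F i) * Const (fps_nth G (k - i))
            * (\<Sum>\<beta>\<in>UNIV. matpow M i $ \<mu> $ \<beta> * matpow M (k - i) $ \<beta> $ \<alpha>)"
        by (simp add: matrix_matrix_mult_def Const_mult)
    qed
    also have "\<dots> = (\<Sum>i=0..k. \<Sum>\<beta>\<in>UNIV. (Const (fps_nth F i) * matpow M i $ \<mu> $ \<beta>)
          * (Const (fps_nth G (k - i)) * matpow M (k - i) $ \<beta> $ \<alpha>))"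
      by (simp add: sum_distrib_left mult_ac)
    also have "\<dots> = fps_nth ((matrix_series M F ** matrix_series M G) $ \<mu> $ \<alpha>) k"
      by (subst sum.swap) (simp add: matrix_matrix_mult_def fps_sum_nth fps_mult_nth)
    finally show ?thesis .
  qed
  then show ?thesis by (simp add: vec_eq_iff fps_eq_iff)
qed

section \<open>Differentiation of series by the symbols and by t\<close>

definition fps_partial :: "'n \<Rightarrow> ('k::field_char_0, 'n::finite) mpoly fps \<Rightarrow> ('k, 'n) mpoly fps" where
  "fps_partial \<mu> p = Abs_fps (\<lambda>k. mderiv (unit_index \<mu>) (fps_nth p k))"

lemma fps_partial_nth [simp]: "fps_nth (fps_partial \<mu> p) k = mderiv (unit_index \<mu>) (fps_nth p k)"
  by (simp add: fps_partial_def)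

lemma fps_partial_add: "fps_partial \<mu> (p + q) = fps_partial \<mu> p + fps_partial \<mu> q"
  and fps_partial_diff: "fps_partial \<mu> (p - q) = fps_partial \<mu> p - fps_partial \<mu> q"
  and fps_partial_zero [simp]: "fps_partial \<mu> 0 = 0"
  and fps_partial_const: "fps_partial \<mu> (fps_const r) = fps_const (mderiv (unit_index \<mu>) r)"
  by (auto simp: fps_eq_iff mderiv_add mderiv_diff)

lemma fps_partial_sum: "fps_partial \<mu> (sum f A) = (\<Sum>i\<in>A. fps_partial \<mu> (f i))"
  by (induction A rule: infinite_finite_induct) (auto simp: fps_partial_add)

lemma fps_partial_mult: "fps_partial \<mu> (p * q) = fps_partial \<mu> p * q + p * fps_partial \<mu> q"
  by (auto simp: fps_eq_iff fps_mult_nth mderiv_sum mderiv_unit_mult sum.distrib)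

lemma fps_partial_one [simp]: "fps_partial \<mu> 1 = 0"
  by (simp add: fps_eq_iff)

lemma fps_partial_X [simp]: "fps_partial \<mu> fps_X = 0"
  by (simp add: fps_eq_iff fps_X_def)

lemma fps_deriv_partial: "fps_deriv (fps_partial \<mu> p) = fps_partial \<mu> (fps_deriv p)"
  unfolding fps_eq_iff fps_deriv_nth fps_partial_nth mderiv_of_nat_mult by blast

definition vec_partial ::
  "'n \<Rightarrow> ('k::field_char_0, 'n::finite) mpoly fps ^ 'm \<Rightarrow> ('k, 'n) mpoly fps ^ 'm" where
  "vec_partial \<mu> v = (\<chi> \<gamma>. fps_partial \<mu> (v $ \<gamma>))"

definition vec_deriv :: "'a::comm_semiring_1 fps ^ 'm \<Rightarrow> 'a fps ^ 'm" where
  "vec_deriv v = (\<chi> \<gamma>. fps_deriv (v $ \<gamma>))"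

lemma vec_partial_diff: "vec_partial \<mu> (u - v) = vec_partial \<mu> u - vec_partial \<mu> v"
  by (simp add: vec_eq_iff vec_partial_def fps_partial_diff)

lemma vec_deriv_diff: "vec_deriv (u - v) = vec_deriv u - (vec_deriv v :: 'a::comm_ring_1 fps ^ 'm)"
  by (simp add: vec_eq_iff vec_deriv_def)

lemma vec_partial_axis [simp]: "vec_partial \<mu> (axis \<nu> 1) = 0"
  by (simp add: vec_eq_iff vec_partial_def axis_def)

lemma vec_deriv_partial: "vec_deriv (vec_partial \<mu> v) = vec_partial \<mu> (vec_deriv v)"
  by (simp add: vec_eq_iff vec_partial_def vec_deriv_def fps_deriv_partial)

abbreviation fps_constants ::
  "('n \<Rightarrow> 'n \<Rightarrow> 'n \<Rightarrow> 'k::field_char_0) \<Rightarrow> 'n \<Rightarrow> 'n \<Rightarrow> 'n \<Rightarrow> ('k, 'n::finite) mpoly fps" where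
  "fps_constants c \<equiv> \<lambda>\<mu> \<nu> \<gamma>. fps_const (Const (c \<mu> \<nu> \<gamma>))"

lemma lie_constants_fps:
  fixes c :: "'n::finite \<Rightarrow> 'n \<Rightarrow> 'n \<Rightarrow> 'k::field_char_0"
  assumes "lie_constants c"
  shows "lie_constants (fps_constants c)"
proof -
  have sk: "c \<mu> \<nu> \<gamma> = - c \<nu> \<mu> \<gamma>" for \<mu> \<nu> \<gamma>
    using assms unfolding lie_constants_def by blast
  have jac: "(\<Sum>\<delta>\<in>UNIV. c \<mu> \<nu> \<delta> * c \<delta> \<kappa> \<gamma>) + (\<Sum>\<delta>\<in>UNIV. c \<nu> \<kappa> \<delta> * c \<delta> \<mu> \<gamma>)
        + (\<Sum>\<delta>\<in>UNIV. c \<kappa> \<mu> \<delta> * c \<delta> \<nu> \<gamma>) = 0" for \<mu> \<nu> \<kappa> \<gamma>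
    using assms unfolding lie_constants_def by blast
  have hom: "(\<Sum>\<delta>\<in>UNIV. fps_const (Const (f \<delta>)) * fps_const (Const (g \<delta>)))
      = (fps_const (Const (\<Sum>\<delta>\<in>UNIV. f \<delta> * g \<delta>)) :: ('k, 'n) mpoly fps)" for f g :: "'n \<Rightarrow> 'k"
    by (auto simp: fps_eq_iff fps_sum_nth Const_sum Const_mult)
  show ?thesis
    unfolding lie_constants_def
  proof (intro conjI allI)
    show "fps_constants c \<mu> \<nu> \<gamma> = - fps_constants c \<nu> \<mu> \<gamma>" for \<mu> \<nu> \<gamma>
      by (subst sk) (simp add: Const_uminus)
    show "(\<Sum>\<delta>\<in>UNIV. fps_constants c \<mu> \<nu> \<delta> * fps_constants c \<delta> \<kappa> \<gamma>)
        + (\<Sum>\<delta>\<in>UNIV. fps_constants c \<nu> \<kappa> \<delta> * fps_constants c \<delta> \<mu> \<gamma>)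
        + (\<Sum>\<delta>\<in>UNIV. fps_constants c \<kappa> \<mu> \<delta> * fps_constants c \<delta> \<nu> \<gamma>) = 0" for \<mu> \<nu> \<kappa> \<gamma>
      unfolding hom by (simp add: jac flip: Const_add)
  qed
qed

lemma vec_partial_vbracket:
  "vec_partial \<alpha> (vbracket (fps_constants c) u v)
     = vbracket (fps_constants c) (vec_partial \<alpha> u) v + vbracket (fps_constants c) u (vec_partial \<alpha> v)"
  by (simp add: vec_eq_iff vbracket_def vec_partial_def fps_partial_sum fps_partial_mult
      fps_partial_const algebra_simps sum.distrib)

lemma vec_deriv_vbracket:
  "vec_deriv (vbracket (fps_constants c) u v)
     = vbracket (fps_constants c) (vec_deriv u) v + vbracket (fps_constants c) u (vec_deriv v)"
  by (simp add: vec_eq_iff vbracket_def vec_deriv_def fps_deriv_sum algebra_simps sum.distrib)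

text \<open>The coordinates of the element D. Here \<open>Var \<alpha>\<close> stands for the symbol
  of \<open>wd \<alpha>\<close>, not for a coordinate on which operators act.\<close>

definition point :: "('k::field_char_0, 'n::finite) mpoly fps ^ 'n" where
  "point = (\<chi> \<alpha>. fps_const (Var \<alpha>))"

lemma vec_partial_point [simp]: "vec_partial \<alpha> point = axis \<alpha> 1"
  by (simp add: vec_eq_iff vec_partial_def point_def axis_def fps_partial_const)

text \<open>The matrix C with commuting variables in place of the operators; \<open>diffop\<close>
  maps its entries to those of \<open>structure_matrix\<close>.\<close>

definition symbol_matrix ::
  "('n \<Rightarrow> 'n \<Rightarrow> 'n \<Rightarrow> 'k::field_char_0) \<Rightarrow> ('k, 'n::finite) mpoly ^ 'n ^ 'n" where
  "symbol_matrix c = (\<chi> \<mu> \<nu>. \<Sum>\<alpha>\<in>UNIV. Const (c \<mu> \<alpha> \<nu>) * Var \<alpha>)"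

lemma vbracket_point:
  fixes c :: "'n::finite \<Rightarrow> 'n \<Rightarrow> 'n \<Rightarrow> 'k::field_char_0"
  shows "vbracket (fps_constants c) v point $ \<gamma> = (\<Sum>\<mu>\<in>UNIV. v $ \<mu> * fps_const (symbol_matrix c $ \<mu> $ \<gamma>))"
proof -
  have "fps_const (\<Sum>\<alpha>\<in>A. f \<alpha>) = (\<Sum>\<alpha>\<in>A. fps_const (f \<alpha>))" for f :: "'n \<Rightarrow> ('k, 'n) mpoly" and A
    by (auto simp: fps_eq_iff fps_sum_nth)
  then show ?thesis
    by (simp add: vbracket_def point_def symbol_matrix_def sum_distrib_left mult_ac del: fps_const_mult
        flip: fps_const_mult)
qed

text \<open>The series (1 - exp(-t))/t, inverse to \<open>psi\<close>. The shift divides exactly by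
  t because 1 - exp(-t) has no constant term.\<close>

definition phi :: "'k::field_char_0 fps" where
  "phi = fps_shift 1 (1 - fps_exp (- 1))"

lemma X_phi: "fps_X * phi = 1 - fps_exp (- 1)"
  by (simp add: phi_def fps_eq_iff)

lemma psi_phi: "psi * phi = 1"
proof -
  have "psi * phi * fps_X = (1 :: 'k::field_char_0 fps) * fps_X"
    using psi_mult X_phi by (metis mult.assoc mult.commute mult_1)
  then show ?thesis by (simp only: mult_cancel_right) simp
qed

text \<open>Row \<alpha> of t phi(t C), which is (1 - exp(-t C))/C written without inverting
  C.\<close>

definition Phi :: "('n \<Rightarrow> 'n \<Rightarrow> 'n \<Rightarrow> 'k::field_char_0) \<Rightarrow> 'n \<Rightarrow> ('k, 'n::finite) mpoly fps ^ 'n" where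
  "Phi c \<alpha> = fps_X *s (matrix_series (symbol_matrix c) phi $ \<alpha>)"

text \<open>Both sides are row \<alpha> of exp(-t C). In coefficients this is (k + 1) phi_k = (-1)^k
  / k!, which equals - phi_(k-1) for k > 0.\<close>

lemma vec_deriv_Phi:
  fixes c :: "'n::finite \<Rightarrow> 'n \<Rightarrow> 'n \<Rightarrow> 'k::field_char_0"
  shows "vec_deriv (Phi c \<alpha>) = axis \<alpha> 1 - vbracket (fps_constants c) (Phi c \<alpha>) point"
proof -
  let ?M = "symbol_matrix c"
  have phi_nth: "of_nat (Suc k) * Const (fps_nth phi k) = (Const ((-1) ^ k / fact k) :: ('k, 'n) mpoly)" for k
  proof -
    have "of_nat (Suc k) * (a / fact (Suc k)) = a / (fact k :: 'k)" for a
      unfolding fact_Suc by (simp del: of_nat_Suc)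
    then have "of_nat (Suc k) * fps_nth phi k = ((-1) ^ k / fact k :: 'k)"
      by (simp add: phi_def del: of_nat_Suc fact_Suc)
    then show ?thesis by (simp only: Const_of_nat[symmetric] Const_mult[symmetric])
  qed
  have "fps_nth (vec_deriv (Phi c \<alpha>) $ \<gamma>) k
      = fps_nth ((axis \<alpha> 1 - vbracket (fps_constants c) (Phi c \<alpha>) point) $ \<gamma>) k" for \<gamma> k
  proof -
    have "fps_nth (vec_deriv (Phi c \<alpha>) $ \<gamma>) k = Const ((-1) ^ k / fact k) * matpow ?M k $ \<alpha> $ \<gamma>"
      unfolding phi_nth[symmetric] by (simp add: vec_deriv_def Phi_def algebra_simps)
    also have "\<dots> = fps_nth ((axis \<alpha> 1 - vbracket (fps_constants c) (Phi c \<alpha>) point) $ \<gamma>) k"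
    proof (cases k)
      case 0
      then show ?thesis
        by (simp add: vbracket_point fps_sum_nth axis_def mat_def Phi_def)
    next
      case (Suc j)
      have coeff: "(-1) ^ k / fact k = - fps_nth phi j"
        by (simp add: phi_def Suc algebra_simps)
      show ?thesis unfolding coeff
        by (simp add: vbracket_point fps_sum_nth axis_def Phi_def Suc matpow_Suc_right Const_uminus
            matrix_matrix_mult_def sum_distrib_left mult.assoc sum_negf del: matpow.simps fact_Suc)
    qed
    finally show ?thesis .
  qed
  then show ?thesis by (simp add: vec_eq_iff fps_eq_iff)
qed

text \<open>Since \<open>point\<close> is constant in t, the equation expresses coefficient k + 1 of
  \<open>v\<close> through coefficient k alone. The factor k + 1 is cancelled in the ground field,
  which has characteristic zero.\<close>

lemma linear_ode_zero:
  fixes v :: "('k::field_char_0, 'n::finite) mpoly fps ^ 'n"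
  assumes "vec_deriv v = - vbracket (fps_constants c) v point"
    and "\<And>\<gamma>. fps_nth (v $ \<gamma>) 0 = 0"
  shows "v = 0"
proof -
  have "\<forall>\<gamma>. fps_nth (v $ \<gamma>) k = 0" for k
  proof (induction k)
    case (Suc k)
    show ?case
    proof
      fix \<gamma>
      have "of_nat (Suc k) * fps_nth (v $ \<gamma>) (Suc k) = fps_nth (vec_deriv v $ \<gamma>) k"
        by (simp add: vec_deriv_def del: of_nat_Suc)
      also have "\<dots> = 0"
        using Suc by (simp add: assms(1) vbracket_point fps_sum_nth)
      finally have "of_nat (Suc k) * lookup (fps_nth (v $ \<gamma>) (Suc k)) \<beta> = 0" for \<beta>
        by (metis lookup_of_nat_mult lookup_zero)
      then show "fps_nth (v $ \<gamma>) (Suc k) = 0"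
        by (intro poly_mapping_eqI) (simp del: of_nat_Suc)
    qed
  qed (simp add: assms)
  then show ?thesis by (simp add: vec_eq_iff fps_eq_iff)
qed

lemma maurer_cartan:
  assumes "lie_constants c"
  shows "vec_partial \<alpha> (Phi c \<beta>) - vec_partial \<beta> (Phi c \<alpha>) = vbracket (fps_constants c) (Phi c \<alpha>) (Phi c \<beta>)"
proof -
  let ?br = "vbracket (fps_constants c)"
  note lie = lie_constants_fps[OF assms]
  define F where "F = vec_partial \<alpha> (Phi c \<beta>) - vec_partial \<beta> (Phi c \<alpha>) - ?br (Phi c \<alpha>) (Phi c \<beta>)"
  \<comment> \<open>Differentiating \<open>point\<close> by the symbols yields brackets with axis
    vectors. They cancel against those from the t-derivative of the quadratic term, one pair
    directly and the other by skew-symmetry; the derivation rule collects the remaining double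
    brackets.\<close>
  have F: "vec_deriv F = - ?br F point"
    unfolding F_def vec_deriv_diff vec_deriv_partial vec_deriv_vbracket vec_deriv_Phi
      vec_partial_diff vec_partial_vbracket vec_partial_point vbracket_diff
      vbracket_derivation[OF lie, of "Phi c \<alpha>" "Phi c \<beta>" point]
    using vbracket_skew[OF lie, of "axis \<alpha> 1" "Phi c \<beta>"]
    by simp
  \<comment> \<open>Every \<open>Phi\<close> carries a factor t, so the linear and the quadratic
    terms all vanish at t = 0.\<close>
  have "F = 0"
  proof (rule linear_ode_zero[OF F])
    fix \<gamma>
    show "fps_nth (F $ \<gamma>) 0 = 0"
      by (simp add: F_def vec_partial_def Phi_def vbracket_def fps_sum_nth)
  qed
  then show ?thesis by (simp add: F_def)
qed

section \<open>The dual equation for \<open>\<psi>\<close>\<close>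

definition Psi :: "('n \<Rightarrow> 'n \<Rightarrow> 'n \<Rightarrow> 'k::field_char_0) \<Rightarrow> ('k, 'n::finite) mpoly fps ^ 'n ^ 'n" where
  "Psi c = matrix_series (symbol_matrix c) psi"

lemma phi_psi: "phi * psi = 1"
  by (metis psi_phi mult.commute)

lemma Psi_Phi: "(\<Sum>\<alpha>\<in>UNIV. (Psi c $ \<mu> $ \<alpha>) *s Phi c \<alpha>) = fps_X *s axis \<mu> 1"
proof -
  have *: "(\<Sum>\<alpha>\<in>UNIV. (Psi c $ \<mu> $ \<alpha>) *s Phi c \<alpha>) $ \<gamma>
      = fps_X * (Psi c ** matrix_series (symbol_matrix c) phi) $ \<mu> $ \<gamma>" for \<gamma>
    by (simp add: Phi_def matrix_matrix_mult_def sum_distrib_left mult_ac)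
  have "Psi c ** matrix_series (symbol_matrix c) phi = mat 1"
    by (simp add: Psi_def psi_phi matrix_series_one flip: matrix_series_mult)
  then show ?thesis unfolding vec_eq_iff * by (simp add: mat_def axis_def)
qed

text \<open>The product in the other order recovers t v from the combination of the rows of
  \<open>Phi\<close> with coefficients \<open>v\<close>; hence these rows are linearly
  independent.\<close>

lemma Phi_Psi:
  "(\<Sum>\<delta>\<in>UNIV. (\<Sum>\<alpha>\<in>UNIV. v $ \<alpha> *s Phi c \<alpha>) $ \<delta> *s Psi c $ \<delta>) = fps_X *s v"
proof -
  let ?P = "matrix_series (symbol_matrix c) phi"
  have "(\<Sum>\<delta>\<in>UNIV. (\<Sum>\<alpha>\<in>UNIV. v $ \<alpha> *s Phi c \<alpha>) $ \<delta> *s Psi c $ \<delta>) $ \<gamma>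
      = (\<Sum>\<delta>\<in>UNIV. \<Sum>\<alpha>\<in>UNIV. fps_X * (v $ \<alpha> * (?P $ \<alpha> $ \<delta> * Psi c $ \<delta> $ \<gamma>)))" for \<gamma>
    by (simp add: Phi_def sum_distrib_right sum_distrib_left mult_ac)
  moreover have "(\<Sum>\<delta>\<in>UNIV. \<Sum>\<alpha>\<in>UNIV. fps_X * (v $ \<alpha> * (?P $ \<alpha> $ \<delta> * Psi c $ \<delta> $ \<gamma>)))
      = (\<Sum>\<alpha>\<in>UNIV. fps_X * (v $ \<alpha> * (?P ** Psi c) $ \<alpha> $ \<gamma>))" for \<gamma>
    by (subst sum.swap) (simp add: matrix_matrix_mult_def sum_distrib_left)
  moreover have "?P ** Psi c = mat 1"
    by (simp add: Psi_def phi_psi matrix_series_one flip: matrix_series_mult)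
  ultimately have eq: "(\<Sum>\<delta>\<in>UNIV. (\<Sum>\<alpha>\<in>UNIV. v $ \<alpha> *s Phi c \<alpha>) $ \<delta> *s Psi c $ \<delta>) $ \<gamma>
      = (\<Sum>\<alpha>\<in>UNIV. fps_X * (v $ \<alpha> * mat 1 $ \<alpha> $ \<gamma>))" for \<gamma>
    by simp
  have "(\<Sum>\<alpha>\<in>UNIV. fps_X * (v $ \<alpha> * mat 1 $ \<alpha> $ \<gamma>)) = (\<Sum>\<alpha>\<in>UNIV. if \<alpha> = \<gamma> then fps_X * v $ \<gamma> else 0)" for \<gamma>
    by (intro sum.cong refl) (simp add: mat_def)
  then show ?thesis unfolding vec_eq_iff eq by simp
qed

lemma Phi_combination_zero:
  fixes v :: "('k::field_char_0, 'n::finite) mpoly fps ^ 'n"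
  assumes "(\<Sum>\<alpha>\<in>UNIV. v $ \<alpha> *s Phi c \<alpha>) = 0"
  shows "v = 0"
proof -
  have "fps_X *s v = 0"
    using Phi_Psi[of v c] by (simp add: assms)
  then have "fps_nth (fps_X * v $ \<gamma>) (Suc k) = 0" for \<gamma> k
    by (simp add: vec_eq_iff)
  then show ?thesis by (simp add: vec_eq_iff fps_eq_iff)
qed

lemma vec_partial_sum: "vec_partial \<mu> (sum f A) = (\<Sum>i\<in>A. vec_partial \<mu> (f i))"
  by (simp add: vec_eq_iff vec_partial_def fps_partial_sum)

lemma vec_partial_scale: "vec_partial \<mu> (r *s v) = fps_partial \<mu> r *s v + r *s vec_partial \<mu> v"
  by (simp add: vec_eq_iff vec_partial_def fps_partial_mult)

text \<open>The rows of \<open>Psi\<close> are, up to a factor t, the vector fields dual to the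
  forms \<open>Phi\<close>, and this is their bracket relation. It is checked after applying the map
  \<open>L\<close>, which is injective by \<open>Phi_combination_zero\<close>.\<close>

lemma Psi_equation:
  fixes c :: "'n::finite \<Rightarrow> 'n \<Rightarrow> 'n \<Rightarrow> 'k::field_char_0"
  assumes lie: "lie_constants c"
  shows "(\<Sum>\<beta>\<in>UNIV. Psi c $ \<nu> $ \<beta> *s vec_partial \<beta> (Psi c $ \<mu>))
       - (\<Sum>\<beta>\<in>UNIV. Psi c $ \<mu> $ \<beta> *s vec_partial \<beta> (Psi c $ \<nu>))
     = (\<Sum>\<gamma>\<in>UNIV. (fps_X * fps_constants c \<mu> \<nu> \<gamma>) *s Psi c $ \<gamma>)"
proof -
  define L where "L v = (\<Sum>\<alpha>\<in>UNIV. v $ \<alpha> *s Phi c \<alpha>)" for v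
  have L_diff: "L (u - v) = L u - L v" for u v
    by (simp add: L_def vector_sub_rdistrib sum_subtractf)
  have L_scale: "L (r *s v) = r *s L v" for r v
    by (simp add: L_def vec_eq_iff sum_distrib_left mult_ac)
  have L_sum: "L (sum f A) = (\<Sum>i\<in>A. L (f i))" for f :: "'n \<Rightarrow> _" and A
  proof -
    have "L (sum f A) $ \<gamma> = (\<Sum>i\<in>A. L (f i)) $ \<gamma>" for \<gamma>
      unfolding L_def by (simp add: sum_distrib_right) (rule sum.swap)
    then show ?thesis by (simp add: vec_eq_iff)
  qed
  have L_Psi: "L (Psi c $ \<rho>) = fps_X *s axis \<rho> 1" for \<rho>
    by (simp add: L_def Psi_Phi)
  \<comment> \<open>The vector \<open>L (Psi c $ \<rho>)\<close> is constant in the symbols, so the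
    product rule moves the derivative from \<open>Psi\<close> to \<open>Phi\<close> at the cost of a
    sign.\<close>
  have L_partial: "L (vec_partial \<beta> (Psi c $ \<rho>))
      = - (\<Sum>\<alpha>\<in>UNIV. Psi c $ \<rho> $ \<alpha> *s vec_partial \<beta> (Phi c \<alpha>))" for \<beta> \<rho>
  proof -
    have "0 = vec_partial \<beta> (L (Psi c $ \<rho>))"
      by (simp add: L_Psi vec_partial_scale)
    also have "\<dots> = L (vec_partial \<beta> (Psi c $ \<rho>)) + (\<Sum>\<alpha>\<in>UNIV. Psi c $ \<rho> $ \<alpha> *s vec_partial \<beta> (Phi c \<alpha>))"
      by (simp add: L_def vec_partial_sum vec_partial_scale sum.distrib) (simp add: vec_partial_def)
    finally show ?thesis by (simp add: eq_neg_iff_add_eq_0)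
  qed
  define S where "S \<mu> \<nu> =
      (\<Sum>\<alpha>\<in>UNIV. \<Sum>\<beta>\<in>UNIV. (Psi c $ \<mu> $ \<alpha> * Psi c $ \<nu> $ \<beta>) *s vec_partial \<beta> (Phi c \<alpha>))" for \<mu> \<nu>
  have L_S: "L (\<Sum>\<beta>\<in>UNIV. Psi c $ \<nu> $ \<beta> *s vec_partial \<beta> (Psi c $ \<mu>)) = - S \<mu> \<nu>" for \<mu> \<nu>
  proof -
    have "L (\<Sum>\<beta>\<in>UNIV. Psi c $ \<nu> $ \<beta> *s vec_partial \<beta> (Psi c $ \<mu>))
        = - (\<Sum>\<beta>\<in>UNIV. \<Sum>\<alpha>\<in>UNIV. (Psi c $ \<mu> $ \<alpha> * Psi c $ \<nu> $ \<beta>) *s vec_partial \<beta> (Phi c \<alpha>))"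
      by (simp add: L_sum L_scale L_partial vec_eq_iff sum_negf sum_distrib_left mult_ac)
    then show ?thesis unfolding S_def by (subst sum.swap)
  qed
  have S_swap: "S \<nu> \<mu> = (\<Sum>\<alpha>\<in>UNIV. \<Sum>\<beta>\<in>UNIV. (Psi c $ \<mu> $ \<alpha> * Psi c $ \<nu> $ \<beta>) *s vec_partial \<alpha> (Phi c \<beta>))"
    unfolding S_def by (subst sum.swap) (simp add: mult.commute)
  have "S \<nu> \<mu> - S \<mu> \<nu> = (\<Sum>\<alpha>\<in>UNIV. \<Sum>\<beta>\<in>UNIV. (Psi c $ \<mu> $ \<alpha> * Psi c $ \<nu> $ \<beta>) *s
      vbracket (fps_constants c) (Phi c \<alpha>) (Phi c \<beta>))"
    unfolding S_swap maurer_cartan[OF lie, symmetric] unfolding S_def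
    by (simp add: vector_ssub_ldistrib sum_subtractf)
  also have "\<dots> = vbracket (fps_constants c) (L (Psi c $ \<mu>)) (L (Psi c $ \<nu>))"
    unfolding L_def vbracket_sum(1) vbracket_sum(2)
    by (subst sum.swap) (simp add: vbracket_scale vec_eq_iff sum_distrib_left mult_ac)
  \<comment> \<open>Bilinearity gives t^2 times the bracket of two basis vectors. One factor t is
    absorbed by \<open>L_Psi\<close>, the other remains in front of \<open>Psi\<close>.\<close>
  also have "\<dots> = L (\<Sum>\<gamma>\<in>UNIV. (fps_X * fps_constants c \<mu> \<nu> \<gamma>) *s Psi c $ \<gamma>)"
  proof -
    have "(\<Sum>\<rho>\<in>UNIV. (fps_X * fps_constants c \<mu> \<nu> \<rho>) * (fps_X * axis \<rho> 1 $ \<gamma>))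
        = (\<Sum>\<rho>\<in>UNIV. if \<rho> = \<gamma> then fps_X * (fps_X * fps_constants c \<mu> \<nu> \<gamma>) else 0)" for \<gamma>
      by (intro sum.cong refl) (auto simp: axis_def)
    then show ?thesis
      by (simp add: L_Psi L_sum L_scale vbracket_scale vec_eq_iff vbracket_axis mult_ac)
  qed
  finally have "L ((\<Sum>\<beta>\<in>UNIV. Psi c $ \<nu> $ \<beta> *s vec_partial \<beta> (Psi c $ \<mu>))
       - (\<Sum>\<beta>\<in>UNIV. Psi c $ \<mu> $ \<beta> *s vec_partial \<beta> (Psi c $ \<nu>))
       - (\<Sum>\<gamma>\<in>UNIV. (fps_X * fps_constants c \<mu> \<nu> \<gamma>) *s Psi c $ \<gamma>)) = 0"
    by (simp add: L_diff L_S)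
  from Phi_combination_zero[OF this[unfolded L_def]] show ?thesis by simp
qed

section \<open>Differential operators with constant coefficients\<close>

definition mdeg :: "'n::finite mindex \<Rightarrow> nat" where
  "mdeg \<beta> = (\<Sum>i\<in>UNIV. lookup \<beta> i)"

lemma mdeg_add: "mdeg (\<alpha> + \<beta>) = mdeg \<alpha> + mdeg \<beta>"
  by (simp add: mdeg_def lookup_add sum.distrib)

lemma mdeg_unit [simp]: "mdeg (unit_index \<mu>) = 1"
  by (simp add: mdeg_def lookup_single when_def)

lemma mderiv_supp_bounded: "\<exists>B. \<forall>\<beta>\<in>mderiv_supp f. mdeg \<beta> \<le> B"
  by (intro exI[of _ "Max (mdeg ` mderiv_supp f)"]) simp

text \<open>Substitutes \<open>wd\<close> for the variables of \<open>p\<close>. The result is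
  already normally ordered, since its coefficients are constant in x.\<close>

definition diffop :: "('k::field_char_0, 'n::finite) mpoly \<Rightarrow> ('k, 'n) weyl" where
  "diffop p = Weyl (\<lambda>\<beta>. Const (lookup p \<beta>))"

lemma wcoeff_diffop [simp]: "wcoeff (diffop p) \<beta> = Const (lookup p \<beta>)"
  by (simp add: diffop_def)

lemma diffop_zero [simp]: "diffop 0 = 0"
  and diffop_add: "diffop (p + q) = diffop p + diffop q"
  by (auto intro!: weyl_eqI simp: lookup_add Const_add)

lemma diffop_sum: "diffop (sum f A) = (\<Sum>i\<in>A. diffop (f i))"
  by (induction A rule: infinite_finite_induct) (auto simp: diffop_add)

lemma diffop_Const_mult: "diffop (Const c * p) = wscale c (diffop p)"
  by (rule weyl_eqI) (simp add: Const_mult)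

lemma wact_sum_left: "sum a A \<rhd> f = (\<Sum>i\<in>A. a i \<rhd> f)"
  by (induction A rule: infinite_finite_induct) (auto simp: wact_add_left)

lemma wact_sum_right: "a \<rhd> sum f A = (\<Sum>i\<in>A. a \<rhd> f i)"
  by (induction A rule: infinite_finite_induct) (auto simp: wact_add_right)

lemma wact_diffop_single: "diffop (Poly_Mapping.single \<kappa> c) \<rhd> f = Const c * mderiv \<kappa> f"
proof -
  have "diffop (Poly_Mapping.single \<kappa> c) \<rhd> f
      = (\<Sum>\<beta>\<in>insert \<kappa> (mderiv_supp f). wcoeff (diffop (Poly_Mapping.single \<kappa> c)) \<beta> * mderiv \<beta> f)"
    by (rule wact_superset) auto
  also have "\<dots> = (\<Sum>\<beta>\<in>insert \<kappa> (mderiv_supp f). if \<beta> = \<kappa> then Const c * mderiv \<kappa> f else 0)"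
    by (intro sum.cong) (auto simp: lookup_single when_def)
  finally show ?thesis by simp
qed

lemma mpoly_sum_induct:
  assumes "P 0" "\<And>p q. P p \<Longrightarrow> P q \<Longrightarrow> P (p + q)" "\<And>\<alpha> c. P (Poly_Mapping.single \<alpha> c)"
  shows "P (p :: ('k::comm_semiring_1, 'n) mpoly)"
proof -
  have "P (\<Sum>\<alpha>\<in>A. Poly_Mapping.single \<alpha> (lookup p \<alpha>))" for A
    using assms by (induction A rule: infinite_finite_induct) auto
  then show ?thesis by (metis poly_mapping_sum_single)
qed

text \<open>For monomials this says that iterated derivatives compose by adding multi-indices, which
  faithfulness of the action lifts to operators. Additivity in each factor gives the rest.\<close>

lemma diffop_mult: "diffop (p * q) = diffop p * diffop q"
proof (induction p rule: mpoly_sum_induct)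
  case (3 \<alpha> c)
  show ?case
  proof (induction q rule: mpoly_sum_induct)
    case (3 \<beta> d)
    show ?case
      by (rule wact_faithful)
        (simp add: mult_single wact_mult wact_diffop_single mderiv_Const_mult mderiv_mderiv Const_mult mult_ac)
  qed (simp_all add: distrib_left diffop_add)
qed (simp_all add: distrib_right diffop_add)

lemma diffop_Var: "diffop (Var \<mu>) = wd \<mu>"
  by (rule wact_faithful) (simp add: Var_def wact_diffop_single wact_wd)

lemma diffop_one: "diffop 1 = 1"
  by (rule weyl_eqI) (simp add: one_weyl_def lookup_one when_def)

section \<open>Commutators with the coordinates\<close>

lemma commutator_mult_left: "commutator (a * b) x = a * commutator b x + commutator a x * b"
  by (simp add: commutator_def algebra_simps)

lemma commutator_wscale_left: "commutator (wscale c a) b = wscale c (commutator a b)"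
  by (rule weyl_eqI) (simp add: commutator_def wscale_mult right_diff_distrib)

text \<open>Both sides obey the product rule in \<open>p\<close> and agree on the variables. Adding
  one variable at a time settles the monomials, and linearity settles the rest.\<close>

lemma commutator_diffop_wx:
  "commutator (diffop p) (wx \<beta>) = diffop (mderiv (unit_index \<beta>) p)"
proof -
  have one: "commutator (diffop (Poly_Mapping.single \<kappa> 1 :: ('a, 'b) mpoly)) (wx \<beta>)
      = diffop (mderiv (unit_index \<beta>) (Poly_Mapping.single \<kappa> 1))" for \<kappa>
  proof (induction \<kappa> rule: mindex_induct)
    case zero
    then show ?case by (simp add: diffop_one commutator_def)
  next
    case (step \<kappa> \<mu>)
    have eq: "Poly_Mapping.single (\<kappa> + unit_index \<mu>) (1 :: 'a) = Poly_Mapping.single \<kappa> 1 * Var \<mu>"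
      by (simp add: Var_def mult_single)
    have "commutator (wd \<mu>) (wx \<beta>) = (diffop (mderiv (unit_index \<beta>) (Var \<mu>)) :: ('a, 'b) weyl)"
      using wd_wx_commutator[of \<mu> \<beta>] by (auto simp: commutator_def diffop_one)
    then show ?case
      unfolding eq diffop_mult commutator_mult_left step mderiv_unit_mult diffop_add diffop_Var
      by simp
  qed
  show ?thesis
  proof (induction p rule: mpoly_sum_induct)
    case 1
    show ?case by (simp add: commutator_def)
  next
    case (2 p q)
    then show ?case
      by (simp add: commutator_def diffop_add mderiv_add distrib_left distrib_right algebra_simps)
  next
    case (3 \<alpha> c)
    have "Poly_Mapping.single \<alpha> c = Const c * Poly_Mapping.single \<alpha> 1"
      by (simp add: Const_def mult_single)
    then show ?case
      using one[of \<alpha>]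
      by (simp only: diffop_Const_mult mderiv_Const_mult commutator_wscale_left)
  qed
qed

text \<open>The power series variable \<open>t\<close> of \<open>mpoly fps\<close> bookkeeps the order in the \<open>\<partial>\<^sub>\<mu>\<close>; tame series are those that
  can be evaluated at \<open>t = 1\<close> in the semicompletion, and \<open>represents p a\<close> below says that \<open>a\<close> is the value.\<close>

definition tame :: "nat \<Rightarrow> ('k::field_char_0, 'n::finite) mpoly fps \<Rightarrow> bool" where
  "tame r p \<longleftrightarrow> (\<forall>k \<beta>. lookup (fps_nth p k) \<beta> \<noteq> 0 \<longrightarrow> k \<le> mdeg \<beta> + r)"

lemma tame_add: "tame r p \<Longrightarrow> tame s q \<Longrightarrow> tame (max r s) (p + q)"
  unfolding tame_def fps_add_nth lookup_add
  by (metis (no_types, opaque_lifting) add.right_neutral add_left_mono le_trans max.cobounded1 max.cobounded2)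

lemma lookup_sum_nonzeroE:
  assumes "lookup (sum f A) \<beta> \<noteq> 0"
  obtains i where "i \<in> A" "lookup (f i) \<beta> \<noteq> 0"
  using assms unfolding lookup_sum by (meson sum.not_neutral_contains_not_neutral)

lemma lookup_mult_nonzeroE:
  fixes p q :: "('k::comm_semiring_1, 'n) mpoly"
  assumes "lookup (p * q) \<beta> \<noteq> 0"
  obtains \<epsilon> \<eta> where "\<beta> = \<epsilon> + \<eta>" "lookup p \<epsilon> \<noteq> 0" "lookup q \<eta> \<noteq> 0"
  using assms keys_mult[of p q] by (auto simp: in_keys_iff subset_iff)

lemma tame_mult:
  assumes "tame r p" "tame s q"
  shows "tame (r + s) (p * q)"
  unfolding tame_def
proof (intro allI impI)
  fix k \<beta>
  assume "lookup (fps_nth (p * q) k) \<beta> \<noteq> 0"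
  then obtain i where "i \<in> {0..k}" "lookup (fps_nth p i * fps_nth q (k - i)) \<beta> \<noteq> 0"
    unfolding fps_mult_nth by (rule lookup_sum_nonzeroE)
  moreover from this(2) obtain \<epsilon> \<eta> where "\<beta> = \<epsilon> + \<eta>"
    "lookup (fps_nth p i) \<epsilon> \<noteq> 0" "lookup (fps_nth q (k - i)) \<eta> \<noteq> 0"
    by (rule lookup_mult_nonzeroE)
  ultimately show "k \<le> mdeg \<beta> + (r + s)"
    using assms unfolding tame_def by (force simp: mdeg_add)
qed

text \<open>Differentiation lowers the degree by one but keeps the exponent of t; the slack
  \<open>r\<close> in \<open>tame\<close> absorbs such shifts.\<close>

lemma tame_partial:
  assumes "tame r p"
  shows "tame (Suc r) (fps_partial \<mu> p)"
  using assms unfolding tame_def by (auto simp: lookup_mderiv mdeg_add)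
    (metis add.commute add_Suc mdeg_add mdeg_unit plus_1_eq_Suc)

lemma tame_X: "tame 1 fps_X" and tame_const: "tame 0 (fps_const r)"
  by (auto simp: tame_def fps_X_def)

text \<open>By tameness only the indices k up to \<open>mdeg \<beta> + r\<close> contribute to the
  coefficient at \<beta>. Each coefficient of the limit is therefore a finite sum, reached uniformly
  for all \<beta> of bounded degree.\<close>

lemma tame_weyl_sums:
  assumes "tame r p"
  shows "\<exists>a. (\<lambda>k. diffop (fps_nth p k)) weyl_sums a"
proof
  let ?a = "Weyl (\<lambda>\<beta>. Const (\<Sum>k | lookup (fps_nth p k) \<beta> \<noteq> 0. lookup (fps_nth p k) \<beta>))"
  have "wcoeff (\<Sum>k<N. diffop (fps_nth p k)) \<beta> = wcoeff ?a \<beta>" if "N \<ge> d + r" "mdeg \<beta> < d" for N d \<beta>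
  proof -
    have "(\<Sum>k<N. lookup (fps_nth p k) \<beta>) = (\<Sum>k | lookup (fps_nth p k) \<beta> \<noteq> 0. lookup (fps_nth p k) \<beta>)"
      by (rule sum.mono_neutral_right) (use assms that in \<open>fastforce simp: tame_def\<close>)+
    then show ?thesis by (simp add: wcoeff_sum flip: Const_sum)
  qed
  then show "(\<lambda>k. diffop (fps_nth p k)) weyl_sums ?a"
    unfolding weyl_sums_def eventually_sequentially mdeg_def[symmetric] by blast
qed

text \<open>Only finitely many iterated derivatives of \<open>f\<close> are nonzero, so the action
  on \<open>f\<close> sees only coefficients of bounded order, and these are eventually
  constant.\<close>

lemma weyl_sums_wact:
  fixes s :: "('k::comm_ring_1, 'n::finite) weyl"
  assumes "a weyl_sums s"
  shows "\<forall>\<^sub>F N in sequentially. s \<rhd> f = (\<Sum>k<N. a k \<rhd> f)"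
proof -
  obtain B where B: "\<And>\<beta>. \<beta> \<in> mderiv_supp f \<Longrightarrow> mdeg \<beta> \<le> B"
    using mderiv_supp_bounded by blast
  have "\<forall>\<^sub>F N in sequentially. \<forall>\<beta>. mdeg \<beta> < Suc B \<longrightarrow> wcoeff (\<Sum>k<N. a k) \<beta> = wcoeff s \<beta>"
    using assms unfolding weyl_sums_def mdeg_def by blast
  then show ?thesis
  proof eventually_elim
    case (elim N)
    have "s \<rhd> f = (\<Sum>k<N. a k) \<rhd> f"
      unfolding wact_def using elim B by (intro sum.cong) (auto simp: less_Suc_eq_le)
    then show ?case by (simp add: wact_sum_left)
  qed
qed

lemma wact_diffop_eq_0:
  assumes "\<And>\<beta>. \<beta> \<in> mderiv_supp f \<Longrightarrow> lookup p \<beta> = 0"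
  shows "diffop p \<rhd> f = 0"
  by (simp add: wact_def assms)

text \<open>The value at t = 1 is described through the action on polynomials, where all sums are
  finite; products and commutators of values can then be computed term by term.\<close>

definition represents :: "('k::field_char_0, 'n::finite) mpoly fps \<Rightarrow> ('k, 'n) weyl \<Rightarrow> bool" where
  "represents p a \<longleftrightarrow> (\<exists>r. tame r p) \<and>
     (\<forall>f. \<forall>\<^sub>F N in sequentially. a \<rhd> f = (\<Sum>k<N. diffop (fps_nth p k) \<rhd> f))"

lemma representsI:
  "tame r p \<Longrightarrow> (\<And>f. \<forall>\<^sub>F N in sequentially. a \<rhd> f = (\<Sum>k<N. diffop (fps_nth p k) \<rhd> f)) \<Longrightarrow> represents p a"
  unfolding represents_def by blast

lemma representsD:
  "represents p a \<Longrightarrow> \<forall>\<^sub>F N in sequentially. a \<rhd> f = (\<Sum>k<N. diffop (fps_nth p k) \<rhd> f)"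
  unfolding represents_def by blast

lemma representsE:
  assumes "represents p a"
  obtains r where "tame r p"
  using assms unfolding represents_def by blast

text \<open>Faithfulness of the action gives uniqueness. Identities between series are transferred
  to the semicompletion in this way.\<close>

lemma represents_unique:
  assumes "represents p a" "represents p b"
  shows "a = b"
proof (rule wact_faithful)
  fix f
  have "\<forall>\<^sub>F N::nat in sequentially. a \<rhd> f = b \<rhd> f"
    using representsD[OF assms(1), of f] representsD[OF assms(2), of f] by eventually_elim simp
  then show "a \<rhd> f = b \<rhd> f" by simp
qed

lemma represents_add:
  assumes "represents p a" "represents q b"
  shows "represents (p + q) (a + b)"
proof -
  obtain r s where rs: "tame r p" "tame s q" using assms by (meson representsE)
  show ?thesis
  proof (rule representsI[OF tame_add[OF rs]])
    fix f
    show "\<forall>\<^sub>F N in sequentially. (a + b) \<rhd> f = (\<Sum>k<N. diffop (fps_nth (p + q) k) \<rhd> f)"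
      using representsD[OF assms(1), of f] representsD[OF assms(2), of f]
      by eventually_elim (simp add: wact_add_left diffop_add sum.distrib)
  qed
qed

lemma represents_zero: "represents 0 0"
  by (rule representsI[of 0]) (auto simp: tame_def)

lemma represents_sum:
  "(\<And>i. i \<in> A \<Longrightarrow> represents (p i) (a i)) \<Longrightarrow> represents (sum p A) (sum a A)"
  by (induction A rule: infinite_finite_induct) (auto simp: represents_zero represents_add)

lemma represents_Const_mult:
  assumes "represents p a"
  shows "represents (fps_const (Const c) * p) (wscale c a)"
proof -
  obtain r where r: "tame r p" using assms by (rule representsE)
  show ?thesis
  proof (rule representsI[OF tame_mult[OF tame_const r]])
    fix f
    show "\<forall>\<^sub>F N in sequentially. wscale c a \<rhd> f = (\<Sum>k<N. diffop (fps_nth (fps_const (Const c) * p) k) \<rhd> f)"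
      using representsD[OF assms, of f]
      by eventually_elim (simp add: wact_wscale diffop_Const_mult sum_distrib_left)
  qed
qed

lemma represents_diff:
  assumes "represents p a" "represents q b"
  shows "represents (p - q) (a - b)"
proof -
  have "represents (p + fps_const (Const (- 1)) * q) (a + wscale (- 1) b)"
    by (intro represents_add represents_Const_mult assms)
  moreover have "wscale (- 1) b = - b"
    by (rule weyl_eqI) (simp add: Const_uminus)
  moreover have "fps_const (Const (- 1)) * q = - q"
    by (simp add: Const_uminus flip: fps_const_neg)
  ultimately show ?thesis by simp
qed

text \<open>The factor t becomes 1 under evaluation: the partial sums are merely shifted by one
  index.\<close>

lemma represents_X_mult:
  assumes "represents p a"
  shows "represents (fps_X * p) a"
proof -
  obtain r where r: "tame r p" using assms by (rule representsE)
  show ?thesis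
  proof (rule representsI[OF tame_mult[OF tame_X r]])
    fix f
    have "\<forall>\<^sub>F N in sequentially. a \<rhd> f = (\<Sum>k<Suc N. diffop (fps_nth (fps_X * p) k) \<rhd> f)"
      using representsD[OF assms, of f]
      by eventually_elim (simp add: sum.lessThan_Suc_shift del: sum.lessThan_Suc)
    then show "\<forall>\<^sub>F N in sequentially. a \<rhd> f = (\<Sum>k<N. diffop (fps_nth (fps_X * p) k) \<rhd> f)"
      by (subst (asm) eventually_sequentially_Suc)
  qed
qed

text \<open>The formula for \<open>commutator_diffop_wx\<close> is summed term by term, using the
  representation of \<open>a\<close> on both \<open>f\<close> and
  \<open>Var \<beta> * f\<close>.\<close>

lemma represents_partial:
  assumes "represents p a"
  shows "represents (fps_partial \<beta> p) (commutator a (wx \<beta>))"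
proof -
  obtain r where r: "tame r p" using assms by (rule representsE)
  show ?thesis
  proof (rule representsI[OF tame_partial[OF r]])
    fix f
    show "\<forall>\<^sub>F N in sequentially. commutator a (wx \<beta>) \<rhd> f = (\<Sum>k<N. diffop (fps_nth (fps_partial \<beta> p) k) \<rhd> f)"
      using representsD[OF assms, of f] representsD[OF assms, of "Var \<beta> * f"]
      by eventually_elim
        (simp add: commutator_diffop_wx[symmetric] commutator_def wact_diff_left wact_mult wact_wx
          sum_subtractf sum_distrib_left)
  qed
qed

text \<open>The square of indices \<open>k, l < N\<close> may be cut down to the triangle \<open>k + l < N\<close>: by tameness the
  other products have order exceeding the degree of the polynomial acted upon.\<close>

lemma represents_mult:
  fixes p q :: "('k::field_char_0, 'n::finite) mpoly fps"
  assumes "represents p a" "represents q b"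
  shows "represents (p * q) (a * b)"
proof -
  obtain r s where rs: "tame r p" "tame s q" using assms by (meson representsE)
  show ?thesis
  proof (rule representsI[OF tame_mult[OF rs]])
    fix f :: "('k, 'n) mpoly"
    obtain B where B: "\<And>\<beta>. \<beta> \<in> mderiv_supp f \<Longrightarrow> mdeg \<beta> \<le> B"
      using mderiv_supp_bounded by blast
    let ?D = "\<lambda>k l. diffop (fps_nth p k * fps_nth q l) \<rhd> f"
    have zero: "?D k l = 0" if "k + l > B + r + s" for k l
    proof (rule wact_diffop_eq_0, rule ccontr)
      fix \<beta> assume "\<beta> \<in> mderiv_supp f" and "lookup (fps_nth p k * fps_nth q l) \<beta> \<noteq> 0"
      from this(2) obtain \<epsilon> \<eta> where "\<beta> = \<epsilon> + \<eta>" "lookup (fps_nth p k) \<epsilon> \<noteq> 0" "lookup (fps_nth q l) \<eta> \<noteq> 0"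
        by (rule lookup_mult_nonzeroE)
      with rs have "k + l \<le> mdeg \<beta> + r + s"
        unfolding tame_def mdeg_add by (force simp: mdeg_add)
      with B[OF \<open>\<beta> \<in> mderiv_supp f\<close>] that show False by simp
    qed
    have "\<forall>\<^sub>F N in sequentially. N > B + r + s" by (rule eventually_gt_at_top)
    then show "\<forall>\<^sub>F N in sequentially. (a * b) \<rhd> f = (\<Sum>k<N. diffop (fps_nth (p * q) k) \<rhd> f)"
      using representsD[OF assms(1), of "b \<rhd> f"] representsD[OF assms(2), of f]
    proof eventually_elim
      case (elim N)
      have small: "k + l < N" if "?D k l \<noteq> 0" for k l
        using that zero[of k l] elim(1) by linarith
      have "(a * b) \<rhd> f = (\<Sum>k<N. \<Sum>l<N. ?D k l)"
        unfolding wact_mult elim(2) unfolding elim(3) by (simp add: wact_sum_right diffop_mult wact_mult)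
      also have "\<dots> = (\<Sum>(k, l)\<in>{..<N} \<times> {..<N}. ?D k l)"
        by (simp add: sum.cartesian_product)
      also have "\<dots> = (\<Sum>(k, l)\<in>{(k, l). k + l < N}. ?D k l)"
        by (rule sum.mono_neutral_right) (use small in auto)
      also have "\<dots> = (\<Sum>m<N. \<Sum>k\<le>m. ?D k (m - k))"
        by (rule sum.triangle_reindex)
      also have "\<dots> = (\<Sum>m<N. diffop (fps_nth (p * q) m) \<rhd> f)"
        by (simp add: fps_mult_nth diffop_sum wact_sum_left atLeast0AtMost)
      finally show ?case .
    qed
  qed
qed

section \<open>The realization\<close>

lemma matpow_structure_matrix:
  "matpow (structure_matrix c) k $ \<mu> $ \<alpha> = diffop (matpow (symbol_matrix c) k $ \<mu> $ \<alpha>)"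
proof (induction k arbitrary: \<mu>)
  case 0
  show ?case by (simp add: mat_def diffop_one)
next
  case (Suc k)
  have "structure_matrix c $ \<mu> $ \<nu> = diffop (symbol_matrix c $ \<mu> $ \<nu>)" for \<mu> \<nu>
    by (simp add: structure_matrix_def symbol_matrix_def diffop_sum diffop_Const_mult diffop_Var)
  with Suc show ?case
    by (simp add: matrix_matrix_mult_def diffop_sum diffop_mult)
qed

lemma symbol_matrix_degree: "lookup (symbol_matrix c $ \<mu> $ \<nu>) \<beta> \<noteq> 0 \<Longrightarrow> mdeg \<beta> = 1"
  by (auto simp: symbol_matrix_def Var_def lookup_single when_def elim!: lookup_sum_nonzeroE split: if_splits)

text \<open>Homogeneity of degree k makes the exponent of t equal to the order in the symbols,
  whence \<open>Psi\<close> is tame without slack.\<close>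

lemma matpow_symbol_matrix_degree: "lookup (matpow (symbol_matrix c) k $ \<mu> $ \<alpha>) \<beta> \<noteq> 0 \<Longrightarrow> mdeg \<beta> = k"
proof (induction k arbitrary: \<mu> \<beta>)
  case 0
  then show ?case
    by (auto simp: mat_def lookup_one when_def mdeg_def split: if_splits)
next
  case (Suc k)
  from Suc.prems obtain \<nu> where
    "lookup (symbol_matrix c $ \<mu> $ \<nu> * matpow (symbol_matrix c) k $ \<nu> $ \<alpha>) \<beta> \<noteq> 0"
    by (auto simp: matrix_matrix_mult_def elim: lookup_sum_nonzeroE)
  then obtain \<epsilon> \<eta> where "\<beta> = \<epsilon> + \<eta>" "lookup (symbol_matrix c $ \<mu> $ \<nu>) \<epsilon> \<noteq> 0"
    "lookup (matpow (symbol_matrix c) k $ \<nu> $ \<alpha>) \<eta> \<noteq> 0"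
    by (rule lookup_mult_nonzeroE)
  with Suc.IH symbol_matrix_degree show ?case by (fastforce simp: mdeg_add)
qed

lemma tame_Psi: "tame 0 (Psi c $ \<mu> $ \<alpha>)"
  unfolding tame_def Psi_def by (auto dest: matpow_symbol_matrix_degree)

lemma diffop_Psi_nth:
  "diffop (fps_nth (Psi c $ \<mu> $ \<alpha>) k) = wscale (fps_nth psi k) (matpow (structure_matrix c) k $ \<mu> $ \<alpha>)"
  by (simp add: Psi_def diffop_Const_mult matpow_structure_matrix)

text \<open>The definition of \<open>weyl_suminf\<close> by a description is meaningful only if a
  limit exists; tameness of \<open>Psi\<close> provides it.\<close>

lemma fps_matrix_sums:
  "(\<lambda>k. wscale (fps_nth psi k) (matpow (structure_matrix c) k $ \<mu> $ \<alpha>))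
     weyl_sums fps_matrix psi (structure_matrix c) $ \<mu> $ \<alpha>"
proof -
  obtain a where a: "(\<lambda>k. wscale (fps_nth psi k) (matpow (structure_matrix c) k $ \<mu> $ \<alpha>)) weyl_sums a"
    using tame_weyl_sums[OF tame_Psi, of c \<mu> \<alpha>] unfolding diffop_Psi_nth by blast
  then show ?thesis
    using weyl_sums_unique[OF a] by (simp add: fps_matrix_def)
qed

lemma represents_Psi:
  "represents (Psi c $ \<mu> $ \<alpha>) (fps_matrix psi (structure_matrix c) $ \<mu> $ \<alpha>)"
  by (rule representsI[OF tame_Psi], unfold diffop_Psi_nth) (rule weyl_sums_wact[OF fps_matrix_sums])

lemma wscale_sum_right: "wscale r (sum a A) = (\<Sum>i\<in>A. wscale r (a i))"
  by (rule weyl_eqI) (simp add: wcoeff_sum sum_distrib_left)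

text \<open>After moving all coordinates to the left, the terms without derivatives are symmetric in
  \<mu> and \<nu> and cancel. The remaining ones are the two sums of \<open>Psi_equation\<close> at
  t = 1.\<close>

lemma xhat_commutator:
  fixes c :: "'n::finite \<Rightarrow> 'n \<Rightarrow> 'n \<Rightarrow> 'k::field_char_0"
  assumes lie: "lie_constants c"
  shows "commutator (xhat c \<mu>) (xhat c \<nu>) = (\<Sum>\<gamma>\<in>UNIV. wscale (c \<mu> \<nu> \<gamma>) (xhat c \<gamma>))"
proof -
  define a where "a \<mu> \<alpha> = fps_matrix psi (structure_matrix c) $ \<mu> $ \<alpha>" for \<mu> \<alpha>
  define d where "d \<beta> \<mu> \<alpha> = commutator (a \<mu> \<alpha>) (wx \<beta>)" for \<beta> \<mu> \<alpha>
  have rep: "represents (Psi c $ \<mu> $ \<alpha>) (a \<mu> \<alpha>)" for \<mu> \<alpha>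
    unfolding a_def by (rule represents_Psi)
  have rep_d: "represents (fps_partial \<beta> (Psi c $ \<mu> $ \<alpha>)) (d \<beta> \<mu> \<alpha>)" for \<beta> \<mu> \<alpha>
    unfolding d_def by (rule represents_partial[OF rep])
  \<comment> \<open>These operators commute because they are values of series over a commutative
    ring.\<close>
  have comm: "a \<mu> \<alpha> * a \<nu> \<beta> = a \<nu> \<beta> * a \<mu> \<alpha>" for \<mu> \<nu> \<alpha> \<beta>
  proof (rule represents_unique)
    show "represents (Psi c $ \<mu> $ \<alpha> * Psi c $ \<nu> $ \<beta>) (a \<mu> \<alpha> * a \<nu> \<beta>)"
      by (intro represents_mult rep)
    show "represents (Psi c $ \<mu> $ \<alpha> * Psi c $ \<nu> $ \<beta>) (a \<nu> \<beta> * a \<mu> \<alpha>)"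
      by (subst mult.commute) (intro represents_mult rep)
  qed
  \<comment> \<open>Component \<alpha> of \<open>Psi_equation\<close> evaluated at t = 1:
    derivatives by symbols become commutators with \<open>wx\<close>, and the factor t
    disappears.\<close>
  have eq: "(\<Sum>\<beta>\<in>UNIV. d \<beta> \<mu> \<alpha> * a \<nu> \<beta>) - (\<Sum>\<beta>\<in>UNIV. d \<beta> \<nu> \<alpha> * a \<mu> \<beta>)
      = (\<Sum>\<gamma>\<in>UNIV. wscale (c \<mu> \<nu> \<gamma>) (a \<gamma> \<alpha>))" for \<alpha>
  proof (rule represents_unique)
    let ?p = "(\<Sum>\<beta>\<in>UNIV. fps_partial \<beta> (Psi c $ \<mu> $ \<alpha>) * Psi c $ \<nu> $ \<beta>)
      - (\<Sum>\<beta>\<in>UNIV. fps_partial \<beta> (Psi c $ \<nu> $ \<alpha>) * Psi c $ \<mu> $ \<beta>)"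
    show "represents ?p ((\<Sum>\<beta>\<in>UNIV. d \<beta> \<mu> \<alpha> * a \<nu> \<beta>) - (\<Sum>\<beta>\<in>UNIV. d \<beta> \<nu> \<alpha> * a \<mu> \<beta>))"
      by (intro represents_diff represents_sum represents_mult rep rep_d)
    have "?p = (\<Sum>\<gamma>\<in>UNIV. fps_X * (fps_constants c \<mu> \<nu> \<gamma> * Psi c $ \<gamma> $ \<alpha>))"
      using arg_cong[OF Psi_equation[OF lie, of \<nu> \<mu>], of "\<lambda>v. v $ \<alpha>"]
      by (simp add: vec_partial_def mult_ac)
    moreover have "represents \<dots> (\<Sum>\<gamma>\<in>UNIV. wscale (c \<mu> \<nu> \<gamma>) (a \<gamma> \<alpha>))"
      by (intro represents_sum represents_X_mult represents_Const_mult rep)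
    ultimately show "represents ?p (\<Sum>\<gamma>\<in>UNIV. wscale (c \<mu> \<nu> \<gamma>) (a \<gamma> \<alpha>))"
      by (simp only:)
  qed
  \<comment> \<open>Moving \<open>wx \<beta>\<close> to the left past
    \<open>a \<mu> \<alpha>\<close> leaves the correction
    \<open>d \<beta> \<mu> \<alpha>\<close>.\<close>
  have prod: "xhat c \<mu> * xhat c \<nu> = (\<Sum>\<alpha>\<in>UNIV. \<Sum>\<beta>\<in>UNIV. wx \<alpha> * wx \<beta> * a \<mu> \<alpha> * a \<nu> \<beta>)
      + (\<Sum>\<alpha>\<in>UNIV. wx \<alpha> * (\<Sum>\<beta>\<in>UNIV. d \<beta> \<mu> \<alpha> * a \<nu> \<beta>))" for \<mu> \<nu>
  proof -
    have "xhat c \<mu> * xhat c \<nu> = (\<Sum>\<alpha>\<in>UNIV. \<Sum>\<beta>\<in>UNIV. wx \<alpha> * (a \<mu> \<alpha> * wx \<beta>) * a \<nu> \<beta>)"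
      by (simp add: xhat_def a_def sum_product mult.assoc)
    also have "\<dots> = (\<Sum>\<alpha>\<in>UNIV. \<Sum>\<beta>\<in>UNIV. wx \<alpha> * wx \<beta> * a \<mu> \<alpha> * a \<nu> \<beta> + wx \<alpha> * (d \<beta> \<mu> \<alpha> * a \<nu> \<beta>))"
    proof (intro sum.cong refl)
      fix \<alpha> \<beta>
      have "a \<mu> \<alpha> * wx \<beta> = wx \<beta> * a \<mu> \<alpha> + d \<beta> \<mu> \<alpha>"
        by (simp add: d_def commutator_def)
      then show "wx \<alpha> * (a \<mu> \<alpha> * wx \<beta>) * a \<nu> \<beta>
          = wx \<alpha> * wx \<beta> * a \<mu> \<alpha> * a \<nu> \<beta> + wx \<alpha> * (d \<beta> \<mu> \<alpha> * a \<nu> \<beta>)"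
        by (simp add: distrib_left distrib_right mult.assoc)
    qed
    finally show ?thesis by (simp add: sum.distrib sum_distrib_left)
  qed
  have swap: "(\<Sum>\<alpha>\<in>UNIV. \<Sum>\<beta>\<in>UNIV. wx \<alpha> * wx \<beta> * a \<nu> \<alpha> * a \<mu> \<beta>)
      = (\<Sum>\<alpha>\<in>UNIV. \<Sum>\<beta>\<in>UNIV. wx \<alpha> * wx \<beta> * a \<mu> \<alpha> * a \<nu> \<beta>)"
  proof (subst sum.swap, intro sum.cong refl)
    show "wx \<alpha> * wx \<beta> * a \<nu> \<alpha> * a \<mu> \<beta> = wx \<beta> * wx \<alpha> * a \<mu> \<beta> * a \<nu> \<alpha>" for \<alpha> \<beta>
      unfolding wx_wx_commute[of \<alpha> \<beta>] mult.assoc[of _ "a \<nu> \<alpha>"] mult.assoc[of _ "a \<mu> \<beta>"] comm[of \<nu> \<alpha> \<mu> \<beta>] ..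
  qed
  have "commutator (xhat c \<mu>) (xhat c \<nu>) = (\<Sum>\<alpha>\<in>UNIV. wx \<alpha> *
      ((\<Sum>\<beta>\<in>UNIV. d \<beta> \<mu> \<alpha> * a \<nu> \<beta>) - (\<Sum>\<beta>\<in>UNIV. d \<beta> \<nu> \<alpha> * a \<mu> \<beta>)))"
    unfolding commutator_def prod swap by (simp add: right_diff_distrib sum_subtractf)
  also have "\<dots> = (\<Sum>\<gamma>\<in>UNIV. wscale (c \<mu> \<nu> \<gamma>) (xhat c \<gamma>))"
    unfolding eq xhat_def a_def[symmetric] wscale_sum_right sum_distrib_left
    by (subst sum.swap) (simp add: wscale_mult)
  finally show ?thesis .
qed

section \<open>The Bernoulli expansion of the realization\<close>

lemma psi_nth: "fps_nth psi k = (- 1) ^ k / fact k * bernoulli k"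
proof -
  \<comment> \<open>This series will satisfy the equation \<open>psi_mult\<close> that characterizes
    \<open>psi\<close>, since the factor 1 - exp(-t) can be cancelled.\<close>
  define b where "b = Abs_fps (\<lambda>k. (- 1) ^ k / fact k * bernoulli k :: 'a)"
  have "fps_nth (b * (1 - fps_exp (- 1))) m = fps_nth fps_X m" for m
  proof (cases m)
    case 0
    then show ?thesis by simp
  next
    case (Suc n)
    have summand: "fps_nth b k * fps_nth (1 - fps_exp (- 1)) (m - k)
        = - ((- 1) ^ m / fact m) * (of_nat (m choose k) * bernoulli k)" if "k < m" for k
    proof -
      have "(- 1 :: 'a) ^ m = (- 1) ^ k * (- 1) ^ (m - k)"
        using that by (simp flip: power_add)
      then show ?thesis
        using that by (simp add: b_def binomial_fact field_simps)
    qed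
    \<comment> \<open>The Bernoulli recursion with its last term moved to the other side. For m = 1
      only B_0 = 1 is left, which produces the coefficient of t.\<close>
    have rec: "(\<Sum>k<m. of_nat (m choose k) * bernoulli k) = (if m = 1 then 1 else 0 :: 'a)"
    proof (cases "n = 0")
      case False
      then have "of_nat (Suc n) * bernoulli n = - (\<Sum>k<n. of_nat (Suc n choose k) * bernoulli k :: 'a)"
        by (subst bernoulli.simps) (simp del: of_nat_Suc)
      then show ?thesis using False by (simp add: Suc del: of_nat_Suc)
    qed (simp add: Suc bernoulli_0)
    have "fps_nth (b * (1 - fps_exp (- 1))) m = (\<Sum>k<m. fps_nth b k * fps_nth (1 - fps_exp (- 1)) (m - k))"
      unfolding fps_mult_nth by (rule sum.mono_neutral_right) auto
    also have "\<dots> = - ((- 1) ^ m / fact m) * (\<Sum>k<m. of_nat (m choose k) * bernoulli k)"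
      unfolding sum_distrib_left by (intro sum.cong refl summand) simp
    finally show ?thesis by (simp add: rec fps_X_def)
  qed
  then have "b * (1 - fps_exp (- 1)) = psi * (1 - fps_exp (- 1))"
    by (simp add: fps_eq_iff psi_mult del: fps_sub_nth)
  moreover have "(1 - fps_exp (- 1) :: 'a fps) \<noteq> 0"
  proof
    assume "(1 - fps_exp (- 1) :: 'a fps) = 0"
    then have "fps_nth (1 - fps_exp (- 1) :: 'a fps) 1 = 0" by simp
    then show False by simp
  qed
  ultimately have "b = psi" by simp
  moreover have "fps_nth b k = (- 1) ^ k / fact k * bernoulli k" by (simp add: b_def)
  ultimately show ?thesis by metis
qed

text \<open>Left multiplication by a coordinate does not mix orders in the derivatives, hence it is
  continuous for the filtration.\<close>

lemma wcoeff_wx_mult: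
  fixes a :: "('k::field_char_0, 'n::finite) weyl"
  shows "wcoeff (wx \<mu> * a) \<beta> = Var \<mu> * wcoeff a \<beta>"
proof -
  have "wx \<mu> * a = Weyl (\<lambda>\<beta>. Var \<mu> * wcoeff a \<beta>)"
    by (rule wact_faithful, unfold wact_mult wact_wx)
      (simp add: wact_def sum_distrib_left mult.assoc)
  then show ?thesis by simp
qed

lemma weyl_sums_wx_mult:
  fixes s :: "('k::field_char_0, 'n::finite) weyl"
  assumes "a weyl_sums s"
  shows "(\<lambda>k. wx \<mu> * a k) weyl_sums (wx \<mu> * s)"
  unfolding weyl_sums_def
proof
  fix d
  have "\<forall>\<^sub>F N in sequentially. \<forall>\<beta>. (\<Sum>j\<in>UNIV. lookup \<beta> j) < d \<longrightarrow> wcoeff (\<Sum>k<N. a k) \<beta> = wcoeff s \<beta>"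
    using assms unfolding weyl_sums_def by blast
  then show "\<forall>\<^sub>F N in sequentially. \<forall>\<beta>. (\<Sum>j\<in>UNIV. lookup \<beta> j) < d \<longrightarrow>
      wcoeff (\<Sum>k<N. wx \<mu> * a k) \<beta> = wcoeff (wx \<mu> * s) \<beta>"
    by eventually_elim (simp add: wcoeff_wx_mult flip: sum_distrib_left)
qed

lemma weyl_sums_sum:
  fixes s :: "'i \<Rightarrow> ('k::ab_group_add, 'n::finite) weyl"
  assumes "finite A" "\<And>i. i \<in> A \<Longrightarrow> a i weyl_sums s i"
  shows "(\<lambda>k. \<Sum>i\<in>A. a i k) weyl_sums (\<Sum>i\<in>A. s i)"
  unfolding weyl_sums_def
proof
  fix d
  have "\<forall>\<^sub>F N in sequentially. \<forall>i\<in>A. \<forall>\<beta>. (\<Sum>j\<in>UNIV. lookup \<beta> j) < d \<longrightarrow> wcoeff (\<Sum>k<N. a i k) \<beta> = wcoeff (s i) \<beta>"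
    using assms by (simp add: eventually_ball_finite weyl_sums_def)
  then show "\<forall>\<^sub>F N in sequentially. \<forall>\<beta>. (\<Sum>j\<in>UNIV. lookup \<beta> j) < d \<longrightarrow>
      wcoeff (\<Sum>k<N. \<Sum>i\<in>A. a i k) \<beta> = wcoeff (\<Sum>i\<in>A. s i) \<beta>"
    by eventually_elim (subst sum.swap, simp add: wcoeff_sum)
qed

lemma xhat_sums:
  "(\<lambda>k. \<Sum>\<alpha>\<in>UNIV. wscale ((- 1) ^ k / fact k * bernoulli k)
       (wx \<alpha> * matpow (structure_matrix c) k $ \<mu> $ \<alpha>)) weyl_sums xhat c \<mu>"
  unfolding xhat_def psi_nth[symmetric] wscale_mult(2)[symmetric]
  by (intro weyl_sums_sum weyl_sums_wx_mult fps_matrix_sums) simp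

section \<open>Symmetrization\<close>

lemma mderiv_unit_power:
  fixes p :: "('k::field_char_0, 'n::finite) mpoly"
  shows "mderiv (unit_index \<mu>) (p ^ m) = of_nat m * p ^ (m - 1) * mderiv (unit_index \<mu>) p"
proof (induction m)
  case (Suc m)
  then show ?case by (cases m) (simp_all add: mderiv_unit_mult algebra_simps)
qed simp

text \<open>By skew-symmetry, the row vector \<open>k\<close> is in the kernel of the matrix \<open>\<^bold>C\<close> with \<open>\<partial>\<^sub>\<alpha>\<close> replaced by \<open>k\<^sub>\<alpha>\<close>,
  which is how \<open>\<^bold>C\<close> acts on powers of the linear form \<open>k \<cdot> x\<close>, up to scalars and lowering the exponent.\<close>

lemma symbol_matrix_kills_power:
  fixes c :: "'n::finite \<Rightarrow> 'n \<Rightarrow> 'n \<Rightarrow> 'k::field_char_0"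
  assumes skew: "\<And>\<mu> \<nu> \<gamma>. c \<mu> \<nu> \<gamma> = - c \<nu> \<mu> \<gamma>"
  shows "diffop (\<Sum>\<mu>\<in>UNIV. Const (k \<mu>) * symbol_matrix c $ \<mu> $ \<nu>)
    \<rhd> (\<Sum>\<mu>\<in>UNIV. Const (k \<mu>) * Var \<mu>) ^ m = 0"
proof -
  let ?l = "\<Sum>\<mu>\<in>UNIV. Const (k \<mu>) * Var \<mu> :: ('k, 'n) mpoly"
  have dl: "mderiv (unit_index \<alpha>) ?l = Const (k \<alpha>)" for \<alpha>
  proof -
    have "mderiv (unit_index \<alpha>) ?l = (\<Sum>\<mu>\<in>UNIV. if \<mu> = \<alpha> then Const (k \<alpha>) else 0)"
      unfolding mderiv_sum mderiv_Const_mult by (intro sum.cong refl) simp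
    then show ?thesis by simp
  qed
  have "(\<Sum>\<mu>\<in>UNIV. \<Sum>\<alpha>\<in>UNIV. k \<mu> * k \<alpha> * c \<mu> \<alpha> \<nu>) = (\<Sum>\<alpha>\<in>UNIV. \<Sum>\<mu>\<in>UNIV. k \<mu> * k \<alpha> * c \<mu> \<alpha> \<nu>)"
    by (rule sum.swap)
  also have "\<dots> = (\<Sum>\<alpha>\<in>UNIV. \<Sum>\<mu>\<in>UNIV. - (k \<alpha> * k \<mu> * c \<alpha> \<mu> \<nu>))"
    by (intro sum.cong refl) (metis skew mult.commute mult_minus_right)
  finally have zero: "(\<Sum>\<mu>\<in>UNIV. \<Sum>\<alpha>\<in>UNIV. k \<mu> * k \<alpha> * c \<mu> \<alpha> \<nu>) = 0"
    by (simp add: sum_negf)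
  have "diffop (\<Sum>\<mu>\<in>UNIV. Const (k \<mu>) * symbol_matrix c $ \<mu> $ \<nu>)
      = (\<Sum>\<mu>\<in>UNIV. \<Sum>\<alpha>\<in>UNIV. wscale (k \<mu>) (wscale (c \<mu> \<alpha> \<nu>) (wd \<alpha>)))"
    by (simp add: diffop_sum symbol_matrix_def diffop_Const_mult diffop_Var wscale_sum_right)
  then have "diffop (\<Sum>\<mu>\<in>UNIV. Const (k \<mu>) * symbol_matrix c $ \<mu> $ \<nu>) \<rhd> ?l ^ m
      = (\<Sum>\<mu>\<in>UNIV. \<Sum>\<alpha>\<in>UNIV. Const (k \<mu> * k \<alpha> * c \<mu> \<alpha> \<nu>) * (of_nat m * ?l ^ (m - 1)))"
    by (simp add: wact_sum_left wact_wscale wact_wd mderiv_unit_power dl Const_mult)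
      (simp add: mult_ac)
  also have "\<dots> = Const (\<Sum>\<mu>\<in>UNIV. \<Sum>\<alpha>\<in>UNIV. k \<mu> * k \<alpha> * c \<mu> \<alpha> \<nu>) * (of_nat m * ?l ^ (m - 1))"
    by (simp add: Const_sum sum_distrib_right)
  finally show ?thesis by (simp add: zero)
qed

text \<open>By induction, each factor acts on a power of the linear form as multiplication by that
  form: after contraction with \<open>k\<close> only the zeroth power of C survives, and its
  coefficient in \<open>psi\<close> is 1.\<close>

lemma xhat_power:
  fixes c :: "'n::finite \<Rightarrow> 'n \<Rightarrow> 'n \<Rightarrow> 'k::field_char_0"
  assumes skew: "\<And>\<mu> \<nu> \<gamma>. c \<mu> \<nu> \<gamma> = - c \<nu> \<mu> \<gamma>"
  shows "(\<Sum>\<mu>\<in>UNIV. wscale (k \<mu>) (xhat c \<mu>)) ^ m \<rhd> 1 = (\<Sum>\<mu>\<in>UNIV. Const (k \<mu>) * Var \<mu>) ^ m"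
proof (induction m)
  case (Suc m)
  let ?l = "\<Sum>\<mu>\<in>UNIV. Const (k \<mu>) * Var \<mu> :: ('k, 'n) mpoly"
  let ?a = "\<lambda>\<mu> \<alpha>. fps_matrix psi (structure_matrix c) $ \<mu> $ \<alpha>"
  let ?M = "symbol_matrix c"
  have higher: "(\<Sum>\<mu>\<in>UNIV. Const (k \<mu>) * (diffop (matpow ?M (Suc j) $ \<mu> $ \<alpha>) \<rhd> ?l ^ m)) = 0" for j \<alpha>
  proof -
    have "(\<Sum>\<mu>\<in>UNIV. Const (k \<mu>) * (diffop (matpow ?M (Suc j) $ \<mu> $ \<alpha>) \<rhd> ?l ^ m))
        = diffop (\<Sum>\<mu>\<in>UNIV. Const (k \<mu>) * matpow ?M (Suc j) $ \<mu> $ \<alpha>) \<rhd> ?l ^ m"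
      by (simp add: diffop_sum diffop_Const_mult wact_sum_left wact_wscale del: matpow.simps)
    \<comment> \<open>Of the factors in C^(j+1), the leftmost is the one contracted with
      \<open>k\<close>. Polynomial entries commute, so it is written last and acts first on the
      power.\<close>
    also have "(\<Sum>\<mu>\<in>UNIV. Const (k \<mu>) * matpow ?M (Suc j) $ \<mu> $ \<alpha>)
        = (\<Sum>\<nu>\<in>UNIV. matpow ?M j $ \<nu> $ \<alpha> * (\<Sum>\<mu>\<in>UNIV. Const (k \<mu>) * ?M $ \<mu> $ \<nu>))"
      by (simp add: matrix_matrix_mult_def sum_distrib_left, subst sum.swap) (simp add: mult_ac)
    also have "diffop \<dots> \<rhd> ?l ^ m = 0"
      by (simp add: diffop_sum[of _ UNIV, where f = "\<lambda>\<nu>. matpow ?M j $ \<nu> $ \<alpha> * _ \<nu>"] diffop_mult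
          wact_sum_left wact_mult symbol_matrix_kills_power[OF skew])
    finally show ?thesis .
  qed
  have row: "(\<Sum>\<mu>\<in>UNIV. Const (k \<mu>) * (?a \<mu> \<alpha> \<rhd> ?l ^ m)) = Const (k \<alpha>) * ?l ^ m" for \<alpha>
  proof -
    have "\<forall>\<^sub>F N in sequentially. \<forall>\<mu>\<in>UNIV. ?a \<mu> \<alpha> \<rhd> ?l ^ m
        = (\<Sum>j<N. wscale (fps_nth psi j) (matpow (structure_matrix c) j $ \<mu> $ \<alpha>) \<rhd> ?l ^ m)"
      by (intro eventually_ball_finite ballI weyl_sums_wact fps_matrix_sums) simp
    then obtain N0 where N0: "\<And>N \<mu>. N \<ge> N0 \<Longrightarrow> ?a \<mu> \<alpha> \<rhd> ?l ^ m
        = (\<Sum>j<N. wscale (fps_nth psi j) (matpow (structure_matrix c) j $ \<mu> $ \<alpha>) \<rhd> ?l ^ m)"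
      unfolding eventually_sequentially by blast
    \<comment> \<open>The bound \<open>N0\<close> serves all \<mu> at once. Truncating at
      \<open>Suc N0\<close> ensures that the term j = 0 is present and can be split off.\<close>
    have "(\<Sum>\<mu>\<in>UNIV. Const (k \<mu>) * (?a \<mu> \<alpha> \<rhd> ?l ^ m))
        = (\<Sum>\<mu>\<in>UNIV. \<Sum>j<Suc N0. Const (fps_nth psi j)
            * (Const (k \<mu>) * (diffop (matpow ?M j $ \<mu> $ \<alpha>) \<rhd> ?l ^ m)))"
      by (simp only: N0[of "Suc N0"] le_SucI order_refl wact_wscale matpow_structure_matrix
          sum_distrib_left mult.left_commute)
    also have "\<dots> = (\<Sum>j<Suc N0. Const (fps_nth psi j)
            * (\<Sum>\<mu>\<in>UNIV. Const (k \<mu>) * (diffop (matpow ?M j $ \<mu> $ \<alpha>) \<rhd> ?l ^ m)))"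
      by (subst sum.swap) (simp only: sum_distrib_left)
    also have "\<dots> = (\<Sum>\<mu>\<in>UNIV. Const (k \<mu>) * (diffop (mat 1 $ \<mu> $ \<alpha>) \<rhd> ?l ^ m))"
      by (simp only: sum.lessThan_Suc_shift higher) (simp add: psi_nth bernoulli_0)
    also have "\<dots> = (\<Sum>\<mu>\<in>UNIV. if \<mu> = \<alpha> then Const (k \<alpha>) * ?l ^ m else 0)"
      by (intro sum.cong refl) (simp add: mat_def diffop_one)
    finally show ?thesis by simp
  qed
  have "(\<Sum>\<mu>\<in>UNIV. wscale (k \<mu>) (xhat c \<mu>)) \<rhd> ?l ^ m
      = (\<Sum>\<mu>\<in>UNIV. \<Sum>\<alpha>\<in>UNIV. Var \<alpha> * (Const (k \<mu>) * (?a \<mu> \<alpha> \<rhd> ?l ^ m)))"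
    by (simp add: wact_sum_left wact_wscale xhat_def wact_mult wact_wx sum_distrib_left mult.left_commute)
  also have "\<dots> = (\<Sum>\<alpha>\<in>UNIV. Var \<alpha> * (Const (k \<alpha>) * ?l ^ m))"
    by (subst sum.swap) (simp only: row flip: sum_distrib_left)
  also have "\<dots> = ?l ^ Suc m"
    by (simp add: sum_distrib_right mult_ac)
  finally show ?case using Suc by (simp add: wact_mult)
qed simp

section \<open>Passage between a Lie algebra with a basis and its structure constants\<close>

lemma basis_family_unique:
  fixes X :: "'n::finite \<Rightarrow> 'g::ab_group_add" and smul :: "'k::field \<Rightarrow> 'g \<Rightarrow> 'g"
  assumes "vector_space smul" "basis_family smul X"
    and "(\<Sum>\<alpha>\<in>UNIV. smul (a \<alpha>) (X \<alpha>)) = (\<Sum>\<alpha>\<in>UNIV. smul (b \<alpha>) (X \<alpha>))"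
  shows "a \<mu> = b \<mu>"
proof -
  interpret vector_space smul by fact
  have inj: "inj X" and indep: "independent (range X)"
    using assms(2) unfolding basis_family_def by auto
  \<comment> \<open>Independence is a property of the set \<open>range X\<close>; injectivity of
    \<open>X\<close> allows the sum over indices to be rewritten over this set.\<close>
  have "(\<Sum>v\<in>range X. smul (a (inv X v) - b (inv X v)) v) = (\<Sum>\<alpha>\<in>UNIV. smul (a \<alpha> - b \<alpha>) (X \<alpha>))"
    using inj by (simp add: sum.reindex)
  also have "\<dots> = 0"
    using assms(3) by (simp add: scale_left_diff_distrib sum_subtractf)
  finally have "a (inv X (X \<mu>)) - b (inv X (X \<mu>)) = 0"
    using independentD[OF indep, of "range X" "\<lambda>v. a (inv X v) - b (inv X v)" "X \<mu>"] by simp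
  then show ?thesis using inj by simp
qed

text \<open>Skew-symmetry and the Jacobi identity are expanded on basis vectors; uniqueness of
  coordinates turns them into identities of the constants.\<close>

lemma structure_constants_lie:
  fixes X :: "'n::finite \<Rightarrow> 'g::ab_group_add" and smul :: "'k::field \<Rightarrow> 'g \<Rightarrow> 'g"
  assumes "lie_algebra smul bracket" "basis_family smul X"
    and br: "\<And>\<mu> \<nu>. bracket (X \<mu>) (X \<nu>) = (\<Sum>\<alpha>\<in>UNIV. smul (c \<mu> \<nu> \<alpha>) (X \<alpha>))"
  shows "lie_constants c"
proof -
  interpret lie_algebra smul bracket by fact
  have vs: "vector_space smul" ..
  have skew: "bracket x y = - bracket y x" for x y
  proof -
    have "bracket x y + bracket y x = bracket (x + y) (x + y)"
      by (simp only: bracket_add_left bracket_add_right) (simp add: bracket_self)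
    then show ?thesis by (simp only: bracket_self eq_neg_iff_add_eq_0)
  qed
  have zero: "bracket 0 x = 0" for x
    using bracket_add_left[of 0 0 x] by simp
  have sum: "bracket (\<Sum>i\<in>A. u i) z = (\<Sum>i\<in>A. bracket (u i) z)" for u :: "'n \<Rightarrow> 'g" and z A
    by (induction A rule: infinite_finite_induct) (simp_all add: bracket_add_left zero)
  have nested: "bracket (bracket (X \<mu>) (X \<nu>)) (X \<kappa>)
      = (\<Sum>\<gamma>\<in>UNIV. smul (\<Sum>\<delta>\<in>UNIV. c \<mu> \<nu> \<delta> * c \<delta> \<kappa> \<gamma>) (X \<gamma>))" for \<mu> \<nu> \<kappa>
  proof -
    have "bracket (bracket (X \<mu>) (X \<nu>)) (X \<kappa>) = (\<Sum>\<delta>\<in>UNIV. \<Sum>\<gamma>\<in>UNIV. smul (c \<mu> \<nu> \<delta> * c \<delta> \<kappa> \<gamma>) (X \<gamma>))"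
      unfolding br[of \<mu> \<nu>] sum bracket_scale_left br by (simp add: scale_sum_right)
    then show ?thesis by (subst (asm) sum.swap) (simp add: scale_sum_left)
  qed
  show ?thesis
    unfolding lie_constants_def
  proof (intro conjI allI)
    fix \<mu> \<nu> \<gamma>
    have "(\<Sum>\<alpha>\<in>UNIV. smul (c \<mu> \<nu> \<alpha>) (X \<alpha>)) = (\<Sum>\<alpha>\<in>UNIV. smul (- c \<nu> \<mu> \<alpha>) (X \<alpha>))"
      using skew[of "X \<mu>" "X \<nu>"] by (simp add: br sum_negf)
    then show "c \<mu> \<nu> \<gamma> = - c \<nu> \<mu> \<gamma>" by (rule basis_family_unique[OF vs assms(2)])
  next
    fix \<mu> \<nu> \<kappa> \<gamma>
    let ?J = "\<lambda>\<mu> \<nu> \<kappa> \<gamma>. \<Sum>\<delta>\<in>UNIV. c \<mu> \<nu> \<delta> * c \<delta> \<kappa> \<gamma>"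
    \<comment> \<open>The axiom \<open>jacobi\<close> nests brackets on the right; flipping each
      outer bracket changes only the common sign and matches \<open>lie_constants\<close>.\<close>
    have "bracket (bracket (X \<mu>) (X \<nu>)) (X \<kappa>) + bracket (bracket (X \<nu>) (X \<kappa>)) (X \<mu>)
        + bracket (bracket (X \<kappa>) (X \<mu>)) (X \<nu>) = 0"
      using jacobi[of "X \<kappa>" "X \<mu>" "X \<nu>"]
      by (simp add: skew[of "bracket _ _"] add_eq_0_iff algebra_simps)
    then have "(\<Sum>\<gamma>\<in>UNIV. smul (?J \<mu> \<nu> \<kappa> \<gamma> + ?J \<nu> \<kappa> \<mu> \<gamma> + ?J \<kappa> \<mu> \<nu> \<gamma>) (X \<gamma>)) = (\<Sum>\<gamma>\<in>UNIV. smul 0 (X \<gamma>))"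
      unfolding nested by (simp add: scale_left_distrib sum.distrib)
    then show "?J \<mu> \<nu> \<kappa> \<gamma> + ?J \<nu> \<kappa> \<mu> \<gamma> + ?J \<kappa> \<mu> \<nu> \<gamma> = 0"
      by (rule basis_family_unique[OF vs assms(2)])
  qed
qed

text \<open>The assignment on the basis extends linearly. Compatibility with brackets spreads from
  basis vectors by span induction, first in the left argument and then in the right one.\<close>

lemma lie_algebra_hom_from_basis:
  fixes X :: "'n::finite \<Rightarrow> 'g::ab_group_add" and Y :: "'n \<Rightarrow> 'h::ab_group_add"
    and smul\<^sub>1 :: "'k::field \<Rightarrow> 'g \<Rightarrow> 'g" and smul\<^sub>2 :: "'k \<Rightarrow> 'h \<Rightarrow> 'h"
  assumes "lie_algebra smul\<^sub>1 bracket\<^sub>1" "lie_algebra smul\<^sub>2 bracket\<^sub>2" "basis_family smul\<^sub>1 X"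
    and br1: "\<And>\<mu> \<nu>. bracket\<^sub>1 (X \<mu>) (X \<nu>) = (\<Sum>\<alpha>\<in>UNIV. smul\<^sub>1 (c \<mu> \<nu> \<alpha>) (X \<alpha>))"
    and br2: "\<And>\<mu> \<nu>. bracket\<^sub>2 (Y \<mu>) (Y \<nu>) = (\<Sum>\<alpha>\<in>UNIV. smul\<^sub>2 (c \<mu> \<nu> \<alpha>) (Y \<alpha>))"
  shows "\<exists>\<rho>. lie_algebra_hom smul\<^sub>1 bracket\<^sub>1 smul\<^sub>2 bracket\<^sub>2 \<rho> \<and> (\<forall>\<mu>. \<rho> (X \<mu>) = Y \<mu>)"
proof -
  interpret g: lie_algebra smul\<^sub>1 bracket\<^sub>1 by fact
  interpret h: lie_algebra smul\<^sub>2 bracket\<^sub>2 by fact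
  interpret vector_space_pair smul\<^sub>1 smul\<^sub>2 ..
  have inj: "inj X" and indep: "g.independent (range X)" and span: "g.span (range X) = UNIV"
    using assms(3) unfolding basis_family_def by auto
  obtain \<rho> where lin: "Vector_Spaces.linear smul\<^sub>1 smul\<^sub>2 \<rho>" and \<rho>: "\<And>v. v \<in> range X \<Longrightarrow> \<rho> v = Y (inv X v)"
    using linear_independent_extend[OF indep, of "\<lambda>v. Y (inv X v)"] by blast
  interpret \<rho>: Vector_Spaces.linear smul\<^sub>1 smul\<^sub>2 \<rho> by (rule lin)
  have \<rho>X: "\<rho> (X \<mu>) = Y \<mu>" for \<mu>
    using \<rho>[of "X \<mu>"] inj by simp
  have zero: "bracket\<^sub>1 0 z = 0" "bracket\<^sub>1 z 0 = 0" "bracket\<^sub>2 0 w = 0" "bracket\<^sub>2 w 0 = 0" for z w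
    using g.bracket_add_left[of 0 0 z] g.bracket_add_right[of z 0 0]
      h.bracket_add_left[of 0 0 w] h.bracket_add_right[of w 0 0] by simp_all
  have 1: "\<rho> (bracket\<^sub>1 x (X \<nu>)) = bracket\<^sub>2 (\<rho> x) (\<rho> (X \<nu>))" for x \<nu>
  proof -
    have "x \<in> g.span (range X)" using span by simp
    then show ?thesis
    proof (induction rule: g.span_induct_alt)
      case base
      show ?case by (simp add: zero \<rho>.zero)
    next
      case (step r v y)
      then show ?case
        by (auto simp: g.bracket_add_left g.bracket_scale_left h.bracket_add_left h.bracket_scale_left
            \<rho>.add \<rho>.scale \<rho>X br1 br2 \<rho>.sum)
    qed
  qed
  have "\<rho> (bracket\<^sub>1 x y) = bracket\<^sub>2 (\<rho> x) (\<rho> y)" for x y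
  proof -
    have "y \<in> g.span (range X)" using span by simp
    then show ?thesis
    proof (induction rule: g.span_induct_alt)
      case base
      show ?case by (simp add: zero \<rho>.zero)
    next
      case (step r v y)
      then show ?case
        by (auto simp: g.bracket_add_right g.bracket_scale_right h.bracket_add_right h.bracket_scale_right
            \<rho>.add \<rho>.scale 1)
    qed
  qed
  with lin \<rho>X show ?thesis unfolding lie_algebra_hom_def by blast
qed

theorem theorem4:
  fixes smul :: "'k::real_normed_field \<Rightarrow> 'g::ab_group_add \<Rightarrow> 'g"
    and bracket :: "real \<Rightarrow> 'g \<Rightarrow> 'g \<Rightarrow> 'g"
    and X :: "'n::finite \<Rightarrow> 'g"
    and C :: "real \<Rightarrow> 'n \<Rightarrow> 'n \<Rightarrow> 'n \<Rightarrow> 'k"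
  assumes "\<And>h. lie_algebra smul (bracket h)"
    and "basis_family smul X"
    and "\<And>h \<mu> \<nu>. bracket h (X \<mu>) (X \<nu>) = (\<Sum>\<alpha>\<in>UNIV. smul (C h \<mu> \<nu> \<alpha>) (X \<alpha>))"
    and "\<And>\<mu> \<nu> \<alpha>. ((\<lambda>h. C h \<mu> \<nu> \<alpha>) \<longlongrightarrow> 0) (at 0)"
  shows "\<forall>h.
      (\<exists>\<rho>. lie_algebra_hom smul (bracket h) wscale commutator \<rho> \<and>
           (\<forall>\<mu>. \<rho> (X \<mu>) = xhat (C h) \<mu>)) \<and>
      (\<forall>\<mu>. (\<lambda>k. \<Sum>\<alpha>\<in>UNIV. wscale ((- 1) ^ k / fact k * bernoulli k)
                   (wx \<alpha> * matpow (structure_matrix (C h)) k $ \<mu> $ \<alpha>))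
             weyl_sums xhat (C h) \<mu>) \<and>
      (\<forall>(k :: 'n \<Rightarrow> 'k) m. m \<ge> 1 \<longrightarrow>
         (\<Sum>\<mu>\<in>UNIV. wscale (k \<mu>) (xhat (C h) \<mu>)) ^ m \<rhd> 1
           = (\<Sum>\<mu>\<in>UNIV. Const (k \<mu>) * Var \<mu>) ^ m)"
proof
  fix h
  have lie: "lie_constants (C h)"
    by (rule structure_constants_lie[OF assms(1-3)])
  then have skew: "C h \<mu> \<nu> \<gamma> = - C h \<nu> \<mu> \<gamma>" for \<mu> \<nu> \<gamma>
    unfolding lie_constants_def by blast
  show "(\<exists>\<rho>. lie_algebra_hom smul (bracket h) wscale commutator \<rho> \<and>
           (\<forall>\<mu>. \<rho> (X \<mu>) = xhat (C h) \<mu>)) \<and>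
      (\<forall>\<mu>. (\<lambda>k. \<Sum>\<alpha>\<in>UNIV. wscale ((- 1) ^ k / fact k * bernoulli k)
                   (wx \<alpha> * matpow (structure_matrix (C h)) k $ \<mu> $ \<alpha>))
             weyl_sums xhat (C h) \<mu>) \<and>
      (\<forall>(k :: 'n \<Rightarrow> 'k) m. m \<ge> 1 \<longrightarrow>
         (\<Sum>\<mu>\<in>UNIV. wscale (k \<mu>) (xhat (C h) \<mu>)) ^ m \<rhd> 1
           = (\<Sum>\<mu>\<in>UNIV. Const (k \<mu>) * Var \<mu>) ^ m)"
    by (intro conjI allI impI xhat_sums xhat_power[OF skew]
        lie_algebra_hom_from_basis[OF assms(1) lie_algebra_weyl assms(2) assms(3)] xhat_commutator[OF lie])
qed

end
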